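(* Let $\mathbf{A}\in\mathbb{C}^{m\times n}$ have rank $r_1$, let $\mathbf{B}\in\mathbb{C}^{p\times q}$ have rank $r_2$, let $\mathbf{D}\in\mathbb{C}^{m\times q}$, and let $\mathbf{X}_{LS}=(x_{ij})\in\mathbb{C}^{n\times p}$ be the least squares solution with minimum norm of the matrix equation $\mathbf{A}\mathbf{X}\mathbf{B}=\mathbf{D}$. Put $\widetilde{\mathbf{D}}:=\mathbf{A}^{*}\mathbf{D}\mathbf{B}^{*}\in\mathbb{C}^{n\times p}$, with $i$th row $\tilde{\mathbf{d}}_{i.}$ ($i=1,\ldots,n$) and $j$th column $\tilde{\mathbf{d}}_{.j}$ ($j=1,\ldots,p$). Then the following hold for all $i=1,\ldots,n$ and $j=1,\ldots,p$. (i) If $\operatorname{rank}\mathbf{A}=n$ and $\operatorname{rank}\mathbf{B}=p$, then $$x_{ij}=\frac{\det\left((\mathbf{A}^{*}\mathbf{A})_{.i}(\mathbf{d}^{\mathbf{B}}_{.j})\right)}{\det(\mathbf{A}^{*}\mathbf{A})\cdot\det(\mathbf{B}\mathbf{B}^{*})}\quad\text{and also}\quad x_{ij}=\frac{\det\left((\mathbf{B}\mathbf{B}^{*})_{j.}(\mathbf{d}^{\mathbf{A}}_{i.})\right)}{\det(\mathbf{A}^{*}\mathbf{A})\cdot\det(\mathbf{B}\mathbf{B}^{*})},$$ where $\mathbf{d}^{\mathbf{B}}_{.j}$ is the column vector $$\mathbf{d}^{\mathbf{B}}_{.j}=\left[\det\left((\mathbf{B}\mathbf{B}^{*})_{j.}(\tilde{\mathbf{d}}_{1.})\right),\ldots,\det\left((\mathbf{B}\mathbf{B}^{*})_{j.}(\tilde{\mathbf{d}}_{n.})\right)\right]^{T}\qquad(\mathrm{b}_1)$$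 and $\mathbf{d}^{\mathbf{A}}_{i.}$ is the row vector $$\mathbf{d}^{\mathbf{A}}_{i.}=\left[\det\left((\mathbf{A}^{*}\mathbf{A})_{.i}(\tilde{\mathbf{d}}_{.1})\right),\ldots,\det\left((\mathbf{A}^{*}\mathbf{A})_{.i}(\tilde{\mathbf{d}}_{.p})\right)\right].\qquad(\mathrm{a}_1)$$ (ii) If $\operatorname{rank}\mathbf{A}=r_1<n$ and $\operatorname{rank}\mathbf{B}=r_2<p$, then $$x_{ij}=\frac{\sum_{\beta\in J_{r_1,n}\{i\}}\left|\left((\mathbf{A}^{*}\mathbf{A})_{.i}(\mathbf{d}^{\mathbf{B}}_{.j})\right)_{\beta}^{\beta}\right|}{\sum_{\beta\in J_{r_1,n}}\left|(\mathbf{A}^{*}\mathbf{A})_{\beta}^{\beta}\right|\sum_{\alpha\in I_{r_2,p}}\left|(\mathbf{B}\mathbf{B}^{*})_{\alpha}^{\alpha}\right|}$$ and also $$x_{ij}=\frac{\sum_{\alpha\in I_{r_2,p}\{j\}}\left|\left((\mathbf{B}\mathbf{B}^{*})_{j.}(\mathbf{d}^{\mathbf{A}}_{i.})\right)_{\alpha}^{\alpha}\right|}{\sum_{\beta\in J_{r_1,n}}\left|(\mathbf{A}^{*}\mathbf{A})_{\beta}^{\beta}\right|\sum_{\alpha\in I_{r_2,p}}\left|(\mathbf{B}\mathbf{B}^{*})_{\alpha}^{\alpha}\right|},$$ where $\mathbf{d}^{\mathbf{B}}_{.j}$ is the column vector $$\mathbf{d}^{\mathbf{B}}_{.j}=\left[\sum_{\alpha\in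 I_{r_2,p}\{j\}}\left|\left((\mathbf{B}\mathbf{B}^{*})_{j.}(\tilde{\mathbf{d}}_{1.})\right)_{\alpha}^{\alpha}\right|,\ldots,\sum_{\alpha\in I_{r_2,p}\{j\}}\left|\left((\mathbf{B}\mathbf{B}^{*})_{j.}(\tilde{\mathbf{d}}_{n.})\right)_{\alpha}^{\alpha}\right|\right]^{T}\qquad(\mathrm{b}_2)$$ and $\mathbf{d}^{\mathbf{A}}_{i.}$ is the row vector $$\mathbf{d}^{\mathbf{A}}_{i.}=\left[\sum_{\beta\in J_{r_1,n}\{i\}}\left|\left((\mathbf{A}^{*}\mathbf{A})_{.i}(\tilde{\mathbf{d}}_{.1})\right)_{\beta}^{\beta}\right|,\ldots,\sum_{\beta\in J_{r_1,n}\{i\}}\left|\left((\mathbf{A}^{*}\mathbf{A})_{.i}(\tilde{\mathbf{d}}_{.p})\right)_{\beta}^{\beta}\right|\right].\qquad(\mathrm{a}_2)$$ (iii) If $\operatorname{rank}\mathbf{A}=n$ and $\operatorname{rank}\mathbf{B}=r_2<p$, then $$x_{ij}=\frac{\det\left((\mathbf{A}^{*}\mathbf{A})_{.i}(\mathbf{d}^{\mathbf{B}}_{.j})\right)}{\det(\mathbf{A}^{*}\mathbf{A})\sum_{\alpha\in I_{r_2,p}}\left|(\mathbf{B}\mathbf{B}^{*})_{\alpha}^{\alpha}\right|}\quad\text{and also}\quad x_{ij}=\frac{\sum_{\alpha\in I_{r_2,p}\{j\}}\left|\left((\mathbf{B}\mathbf{B}^{*})_{j.}(\mathbf{d}^{\mathbf{A}}_{i.})\right)_{\alpha}^{\alpha}\right|}{\det(\mathbf{A}^{*}\mathbf{A})\sum_{\alpha\in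 I_{r_2,p}}\left|(\mathbf{B}\mathbf{B}^{*})_{\alpha}^{\alpha}\right|},$$ where $\mathbf{d}^{\mathbf{B}}_{.j}$ is given by formula $(\mathrm{b}_2)$ and $\mathbf{d}^{\mathbf{A}}_{i.}$ is given by formula $(\mathrm{a}_1)$. (iv) If $\operatorname{rank}\mathbf{A}=r_1<n$ and $\operatorname{rank}\mathbf{B}=p$, then $$x_{ij}=\frac{\det\left((\mathbf{B}\mathbf{B}^{*})_{j.}(\mathbf{d}^{\mathbf{A}}_{i.})\right)}{\sum_{\beta\in J_{r_1,n}}\left|(\mathbf{A}^{*}\mathbf{A})_{\beta}^{\beta}\right|\cdot\det(\mathbf{B}\mathbf{B}^{*})}\quad\text{and also}\quad x_{ij}=\frac{\sum_{\beta\in J_{r_1,n}\{i\}}\left|\left((\mathbf{A}^{*}\mathbf{A})_{.i}(\mathbf{d}^{\mathbf{B}}_{.j})\right)_{\beta}^{\beta}\right|}{\sum_{\beta\in J_{r_1,n}}\left|(\mathbf{A}^{*}\mathbf{A})_{\beta}^{\beta}\right|\cdot\det(\mathbf{B}\mathbf{B}^{*})},$$ where $\mathbf{d}^{\mathbf{B}}_{.j}$ is given by formula $(\mathrm{b}_1)$ and $\mathbf{d}^{\mathbf{A}}_{i.}$ is given by formula $(\mathrm{a}_2)$.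
   Context: $\mathbb{C}^{m\times n}$ is the set of complex $m\times n$ matrices, $\mathbf{A}^{*}$ is the Hermitian adjoint (conjugate transpose) of $\mathbf{A}$, and $\|\cdot\|$ is the Frobenius norm. Least squares solutions of $\mathbf{A}\mathbf{X}\mathbf{B}=\mathbf{D}$ are the matrices in $S_3=\{\mathbf{X}\in\mathbb{C}^{n\times p}: \|\mathbf{A}\mathbf{X}\mathbf{B}-\mathbf{D}\|=\min\}$, i.e. the minimizers of $\|\mathbf{A}\mathbf{X}\mathbf{B}-\mathbf{D}\|$ over $\mathbb{C}^{n\times p}$. The least squares solution with minimum norm, $\mathbf{X}_{LS}$, is the element of $S_3$ of smallest Frobenius norm. For a square matrix $\mathbf{M}$, $\mathbf{M}_{.i}(\mathbf{b})$ denotes the matrix obtained from $\mathbf{M}$ by replacing its $i$th column with the column vector $\mathbf{b}$, and $\mathbf{M}_{j.}(\mathbf{b})$ denotes the matrix obtained from $\mathbf{M}$ by replacing its $j$th row with the row vector $\mathbf{b}$. For an index set $\alpha$, $|\mathbf{M}_{\alpha}^{\alpha}|$ denotes the principal minor of $\mathbf{M}$ determined by the rows and columns indexed by $\alpha$. For $1\le k\le n$, both $I_{k,n}$ and $J_{k,n}$ denote the collection of all strictly increasing sequences of $k$ integers chosen from $\{1,\ldots,n\}$ (viewed as $k$-element subsets); $I_{k,n}\{j\}:=\{\alpha\in I_{k,n}: j\in\alpha\}$ and $J_{k,n}\{i\}:=\{\beta\in J_{k,n}: i\in\beta\}$. The ranks $r_1,r_2$ are assumed to be at least $1$ so that these index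 sets are defined. *)

theory Defs
  imports
    Complex_Main
    "Jordan_Normal_Form.Determinant"
    "Jordan_Normal_Form.Schur_Decomposition"
    "Jordan_Normal_Form.DL_Rank"
    "Jordan_Normal_Form.DL_Submatrix"
begin

text \<open>Matrices are those of \<open>Jordan_Normal_Form\<close>, so rows and columns are numbered from \<open>0\<close>:
  the index range \<open>{1,\<dots>,n}\<close> of the mathematics is \<open>{..<n}\<close> throughout.\<close>

definition frobenius_norm :: "complex mat \<Rightarrow> real" where
  "frobenius_norm M = sqrt (\<Sum>i<dim_row M. \<Sum>j<dim_col M. (cmod (M $$ (i, j)))\<^sup>2)"

definition least_squares_solutions ::
    "complex mat \<Rightarrow> complex mat \<Rightarrow> complex mat \<Rightarrow> complex mat set" where
  "least_squares_solutions A B D =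
     {X. is_arg_min (\<lambda>X. frobenius_norm (A * X * B - D))
                    (\<lambda>X. X \<in> carrier_mat (dim_col A) (dim_row B)) X}"

definition is_min_norm_least_squares_solution ::
    "complex mat \<Rightarrow> complex mat \<Rightarrow> complex mat \<Rightarrow> complex mat \<Rightarrow> bool" where
  "is_min_norm_least_squares_solution A B D X \<longleftrightarrow>
     is_arg_min frobenius_norm (\<lambda>Y. Y \<in> least_squares_solutions A B D) X"

text \<open>The row analogue of the library's \<open>replace_col\<close>, with the same argument order.\<close>

definition replace_row :: "'a mat \<Rightarrow> 'a vec \<Rightarrow> nat \<Rightarrow> 'a mat" where
  "replace_row M b k =
     mat (dim_row M) (dim_col M) (\<lambda>(i, j). if i = k then b $ j else M $$ (i, j))"

definition principal_minor :: "'a :: comm_ring_1 mat \<Rightarrow> nat set \<Rightarrow> 'a" where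
  "principal_minor M \<alpha> = det (submatrix M \<alpha> \<alpha>)"

text \<open>\<open>index_sets k n\<close> is \<open>I\<^sub>k\<^sub>,\<^sub>n = J\<^sub>k\<^sub>,\<^sub>n\<close>, strictly increasing sequences being identified with
  their sets of entries; \<open>index_sets_at k n i\<close> is \<open>I\<^sub>k\<^sub>,\<^sub>n{i} = J\<^sub>k\<^sub>,\<^sub>n{i}\<close>.\<close>

definition index_sets :: "nat \<Rightarrow> nat \<Rightarrow> nat set set" where
  "index_sets k n = {\<alpha>. \<alpha> \<subseteq> {..<n} \<and> card \<alpha> = k}"

definition index_sets_at :: "nat \<Rightarrow> nat \<Rightarrow> nat \<Rightarrow> nat set set" where
  "index_sets_at k n i = {\<alpha> \<in> index_sets k n. i \<in> \<alpha>}"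

text \<open>The auxiliary column vector \<open>d\<^sup>B\<close> belonging to column \<open>j\<close> and row vector \<open>d\<^sup>A\<close> belonging
  to row \<open>i\<close>, each in a full-rank (\<open>det\<close>) and a rank-deficient (\<open>minors\<close>) variant.
  The argument \<open>Dt\<close> is meant to be \<open>A\<^sup>* D B\<^sup>*\<close>, and \<open>r\<close> the rank of \<open>B\<close> or \<open>A\<close>.\<close>

definition dB_det :: "complex mat \<Rightarrow> complex mat \<Rightarrow> nat \<Rightarrow> complex vec" where
  "dB_det B Dt j =
     vec (dim_row Dt) (\<lambda>k. det (replace_row (B * mat_adjoint B) (row Dt k) j))"

definition dA_det :: "complex mat \<Rightarrow> complex mat \<Rightarrow> nat \<Rightarrow> complex vec" where
  "dA_det A Dt i =
     vec (dim_col Dt) (\<lambda>l. det (replace_col (mat_adjoint A * A) (col Dt l) i))"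

definition dB_minors :: "nat \<Rightarrow> complex mat \<Rightarrow> complex mat \<Rightarrow> nat \<Rightarrow> complex vec" where
  "dB_minors r B Dt j =
     vec (dim_row Dt) (\<lambda>k. \<Sum>\<alpha> \<in> index_sets_at r (dim_row B) j.
       principal_minor (replace_row (B * mat_adjoint B) (row Dt k) j) \<alpha>)"

definition dA_minors :: "nat \<Rightarrow> complex mat \<Rightarrow> complex mat \<Rightarrow> nat \<Rightarrow> complex vec" where
  "dA_minors r A Dt i =
     vec (dim_col Dt) (\<lambda>l. \<Sum>\<beta> \<in> index_sets_at r (dim_col A) i.
       principal_minor (replace_col (mat_adjoint A * A) (col Dt l) i) \<beta>)"

end

theory Submission
  imports Defs
begin

text \<open>The minimum norm least squares solution \<open>X\<close> satisfies the normal equation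
  \<open>A\<^sup>* A X B B\<^sup>* = A\<^sup>* D B\<^sup>*\<close>, and being orthogonal to every \<open>Z\<close> with \<open>A Z B = 0\<close> it has its columns
  in the range of \<open>A\<^sup>*\<close> and its rows in the row space of \<open>B\<^sup>*\<close>. So it is enough to have Cramer's
  rule for a singular system \<open>M x = b\<close> with \<open>M = A\<^sup>* A\<close> of rank \<open>r\<close> and \<open>x\<close> in the range of \<open>M\<close>:
  compare the coefficients of \<open>t\<^sup>n\<^sup>-\<^sup>r\<close> in the ordinary Cramer rule for \<open>(M + t I) x = b + t x\<close>. This
  is applied once for \<open>A\<^sup>* A\<close> and once, transposed, for \<open>B B\<^sup>*\<close>, in either order. The denominators do
  not vanish: if \<open>A = C F\<close> is a rank factorisation, then the sum of the principal minors of order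
  \<open>r\<close> of \<open>A\<^sup>* A\<close> is \<open>det (C\<^sup>* C)\<close> times the sum of the squared moduli of the \<open>r \<times> r\<close> minors of \<open>F\<close>.\<close>

subsection \<open>Principal minors\<close>

text \<open>Multilinearity in the columns: \<open>\<beta>\<close> records the columns in which
  \<open>C\<close> is chosen, and every other column contributes a factor \<open>t\<close>. If
  \<open>D\<close> is the identity matrix, this expands det (M + t I) in powers of \<open>t\<close>;
  the numerator in Cramer's rule needs a \<open>D\<close> that differs from the identity in one
  column.\<close>

lemma det_add_smult_cols:
  fixes C D :: "nat \<Rightarrow> nat \<Rightarrow> 'a :: comm_ring_1"
  shows "det (mat n n (\<lambda>(a, k). C a k + t * D a k)) =
    (\<Sum>\<beta>\<in>Pow {..<n}. t ^ (n - card \<beta>) *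
       det (mat n n (\<lambda>(a, k). if k \<in> \<beta> then C a k else D a k)))"
proof -
  let ?P = "{p. p permutes {0..<n}}"
  have pn: "p k < n" if "p permutes {0..<n}" "k < n" for p k
    using permutes_in_image[OF that(1), of k] that(2) by simp
  have step: "(\<Prod>k<n. C (p k) k + t * D (p k) k) =
     (\<Sum>\<beta>\<in>Pow {..<n}. t ^ (n - card \<beta>) * (\<Prod>k<n. if k \<in> \<beta> then C (p k) k else D (p k) k))" for p
  proof -
    have "(\<Prod>k<n. C (p k) k + t * D (p k) k) =
      (\<Sum>\<beta>\<in>Pow {..<n}. (\<Prod>k\<in>\<beta>. C (p k) k) * (\<Prod>k\<in>{..<n} - \<beta>. t * D (p k) k))"
      by (rule prod_add) simp
    also have "\<dots> = (\<Sum>\<beta>\<in>Pow {..<n}. t ^ (n - card \<beta>) * (\<Prod>k<n. if k \<in> \<beta> then C (p k) k else D (p k) k))"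
    proof (rule sum.cong[OF refl])
      fix \<beta> assume "\<beta> \<in> Pow {..<n}"
      then have b: "\<beta> \<subseteq> {..<n}" and fin: "finite \<beta>" by (auto intro: finite_subset)
      have "(\<Prod>k<n. if k \<in> \<beta> then C (p k) k else D (p k) k) =
        (\<Prod>k\<in>{..<n} - \<beta>. if k \<in> \<beta> then C (p k) k else D (p k) k) *
        (\<Prod>k\<in>\<beta>. if k \<in> \<beta> then C (p k) k else D (p k) k)"
        by (rule prod.subset_diff[OF b]) simp
      also have "\<dots> = (\<Prod>k\<in>{..<n} - \<beta>. D (p k) k) * (\<Prod>k\<in>\<beta>. C (p k) k)"
        by (auto intro!: arg_cong2[where f = "(*)"] prod.cong)
      finally show "(\<Prod>k\<in>\<beta>. C (p k) k) * (\<Prod>k\<in>{..<n} - \<beta>. t * D (p k) k) =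
        t ^ (n - card \<beta>) * (\<Prod>k<n. if k \<in> \<beta> then C (p k) k else D (p k) k)"
        using b fin by (simp add: prod.distrib card_Diff_subset mult_ac)
    qed
    finally show ?thesis .
  qed
  have "det (mat n n (\<lambda>(a, k). C a k + t * D a k)) =
    (\<Sum>p\<in>?P. signof p * (\<Prod>k<n. C (p k) k + t * D (p k) k))"
    by (subst det_col[of _ n]) (auto intro!: sum.cong prod.cong arg_cong2[where f = "(*)"] simp: pn)
  also have "\<dots> = (\<Sum>\<beta>\<in>Pow {..<n}. t ^ (n - card \<beta>) *
     (\<Sum>p\<in>?P. signof p * (\<Prod>k<n. if k \<in> \<beta> then C (p k) k else D (p k) k)))"
    unfolding step sum_distrib_left by (subst sum.swap) (simp add: mult_ac)
  also have "\<dots> = (\<Sum>\<beta>\<in>Pow {..<n}. t ^ (n - card \<beta>) *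
       det (mat n n (\<lambda>(a, k). if k \<in> \<beta> then C a k else D a k)))"
    by (intro sum.cong refl arg_cong2[where f = "(*)"], subst det_col[of _ n])
      (auto intro!: sum.cong prod.cong arg_cong2[where f = "(*)"] simp: pn)
  finally show ?thesis .
qed

text \<open>The sign of \<open>p\<close> enters once for the rows and once, after transposing, for
  the columns, and its square is 1.\<close>

lemma det_permute_both:
  assumes "K \<in> carrier_mat n n" and "p permutes {0..<n}"
  shows "det (mat n n (\<lambda>(i, j). K $$ (p i, p j))) = det (K :: 'a :: comm_ring_1 mat)"
proof -
  have pn: "p k < n" if "k < n" for k
    using permutes_in_image[OF assms(2), of k] that by simp
  define L where "L = mat n n (\<lambda>(i, j). K $$ (p i, j))"
  have L: "L \<in> carrier_mat n n" "transpose_mat L \<in> carrier_mat n n" unfolding L_def by auto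
  have "mat n n (\<lambda>(i, j). K $$ (p i, p j)) = transpose_mat (mat n n (\<lambda>(i, j). transpose_mat L $$ (p i, j)))"
    by (rule eq_matI) (auto simp: L_def pn)
  also have "det \<dots> = signof p * det L"
    by (subst det_transpose[of _ n]) (auto simp: det_permute_rows[OF L(2) assms(2)] det_transpose[OF L(1)])
  also have "det L = signof p * det K"
    unfolding L_def by (rule det_permute_rows[OF assms])
  finally show ?thesis by (simp add: sign_def)
qed

lemma pick_bij_betw:
  assumes "finite \<beta>"
  shows "bij_betw (pick \<beta>) {..<card \<beta>} \<beta>"
proof -
  have inj: "inj_on (pick \<beta>) {..<card \<beta>}"
    by (rule linorder_inj_onI) (use pick_mono_le in \<open>fastforce+\<close>)
  moreover have "pick \<beta> ` {..<card \<beta>} = \<beta>"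
    by (rule card_subset_eq[OF assms]) (auto simp: pick_in_set_le card_image[OF inj])
  ultimately show ?thesis by (simp add: bij_betw_def)
qed

lemma submatrix_subset:
  assumes "K \<in> carrier_mat n m" and "\<alpha> \<subseteq> {..<n}" and "\<beta> \<subseteq> {..<m}"
  shows "submatrix K \<alpha> \<beta> = mat (card \<alpha>) (card \<beta>) (\<lambda>(i, j). K $$ (pick \<alpha> i, pick \<beta> j))"
proof -
  have "{i. i < n \<and> i \<in> \<alpha>} = \<alpha>" "{i. i < m \<and> i \<in> \<beta>} = \<beta>" using assms by auto
  then show ?thesis using assms(1) unfolding submatrix_def by simp
qed

text \<open>Bringing \<open>\<beta>\<close> to the front by a simultaneous permutation of rows and
  columns makes the matrix on the right block lower triangular, with the submatrix and an identity
  block on the diagonal. In this form all minors are n by n determinants of the kind that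
  \<open>det_add_smult_cols\<close> produces.\<close>

lemma principal_minor_conv_det:
  fixes K :: "'a :: idom mat"
  assumes K: "K \<in> carrier_mat n n" and b: "\<beta> \<subseteq> {..<n}"
  shows "principal_minor K \<beta> =
    det (mat n n (\<lambda>(a, k). if k \<in> \<beta> then K $$ (a, k) else if a = k then 1 else 0))"
proof -
  define r where "r = card \<beta>"
  define \<gamma> where "\<gamma> = {..<n} - \<beta>"
  have fin: "finite \<beta>" "finite \<gamma>" using b by (auto simp: \<gamma>_def intro: finite_subset)
  have rn: "r \<le> n" using card_mono[OF _ b] by (simp add: r_def)
  have cg: "card \<gamma> = n - r" using b fin by (simp add: \<gamma>_def r_def card_Diff_subset)
  \<comment> \<open>\<open>p\<close> lists \<open>\<beta>\<close> in increasing order and then its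
    complement; from \<open>n\<close> on it is the identity, as \<open>permutes\<close>
    demands.\<close>
  define p where "p l = (if l < r then pick \<beta> l else if l < n then pick \<gamma> (l - r) else l)" for l
  have "bij_betw p {..<r} \<beta>"
    using pick_bij_betw[OF fin(1)] unfolding r_def[symmetric]
    by (subst bij_betw_cong[of _ _ "pick \<beta>"]) (auto simp: p_def)
  moreover have "bij_betw p {r..<n} \<gamma>"
  proof -
    have "bij_betw (\<lambda>l. l - r) {r..<n} {..<n - r}"
      by (rule bij_betw_byWitness[of _ "\<lambda>l. l + r"]) auto
    from bij_betw_trans[OF this pick_bij_betw[OF fin(2), unfolded cg]]
    show ?thesis by (subst bij_betw_cong[of _ _ "pick \<gamma> \<circ> (\<lambda>l. l - r)"]) (auto simp: p_def)
  qed
  ultimately have "bij_betw p ({..<r} \<union> {r..<n}) (\<beta> \<union> \<gamma>)"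
    by (rule bij_betw_combine) (auto simp: \<gamma>_def)
  moreover have "{..<r} \<union> {r..<n} = {0..<n}" "\<beta> \<union> \<gamma> = {0..<n}"
    using b rn by (auto simp: \<gamma>_def)
  ultimately have bij: "bij_betw p {0..<n} {0..<n}" by simp
  then have p: "p permutes {0..<n}"
    by (rule bij_imp_permutes) (use rn in \<open>auto simp: p_def\<close>)
  have pn: "p l < n" if "l < n" for l
    using permutes_in_image[OF p, of l] that by simp
  have pinj: "p k = p l \<longleftrightarrow> k = l" for k l
    using permutes_inj[OF p] by (auto dest: injD)
  have pb: "p l \<in> \<beta> \<longleftrightarrow> l < r" if "l < n" for l
  proof (cases "l < r")
    case True
    then show ?thesis using pick_in_set_le[of l \<beta>] by (simp add: p_def r_def)
  next
    case False
    then have "p l \<in> \<gamma>" using that pick_in_set_le[of "l - r" \<gamma>] by (simp add: p_def cg)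
    then show ?thesis using False by (simp add: \<gamma>_def)
  qed
  let ?N = "mat n n (\<lambda>(a, k). if k \<in> \<beta> then K $$ (a, k) else if a = k then 1 else 0)"
  let ?S = "mat r r (\<lambda>(i, j). K $$ (p i, p j))"
  let ?T = "mat (n - r) r (\<lambda>(i, j). K $$ (p (i + r), p j))"
  have "det ?N = det (mat n n (\<lambda>(i, j). ?N $$ (p i, p j)))"
    by (rule det_permute_both[symmetric, OF _ p]) simp
  also have "mat n n (\<lambda>(i, j). ?N $$ (p i, p j)) = four_block_mat ?S (0\<^sub>m r (n - r)) ?T (1\<^sub>m (n - r))"
    by (rule eq_matI) (use rn in \<open>auto simp: pn pb pinj\<close>)
  also have "det \<dots> = det ?S * det (1\<^sub>m (n - r) :: 'a mat)"
    by (rule det_four_block_mat_upper_right_zero) auto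
  also have "?S = submatrix K \<beta> \<beta>"
    unfolding submatrix_subset[OF K b b] r_def[symmetric] by (rule eq_matI) (auto simp: p_def)
  finally show ?thesis by (simp add: principal_minor_def)
qed

text \<open>Padding \<open>P\<close> with zero columns and \<open>Q\<close> with zero rows to square
  matrices does not change the product, and the padded \<open>Q\<close> has a zero row because
  \<open>r < k\<close>.\<close>

lemma det_mult_inner_dim_less:
  fixes P Q :: "'a :: comm_ring_1 mat"
  assumes P: "P \<in> carrier_mat k r" and Q: "Q \<in> carrier_mat r k" and "r < k"
  shows "det (P * Q) = 0"
proof -
  define P' where "P' = mat k k (\<lambda>(i, j). if j < r then P $$ (i, j) else 0)"
  define Q' where "Q' = mat k k (\<lambda>(i, j). if i < r then Q $$ (i, j) else 0)"
  have c: "P' \<in> carrier_mat k k" "Q' \<in> carrier_mat k k" by (auto simp: P'_def Q'_def)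
  have "P * Q = P' * Q'"
  proof (rule eq_matI)
    fix i j assume "i < dim_row (P' * Q')" "j < dim_col (P' * Q')"
    then have ij: "i < k" "j < k" using c by auto
    have "(\<Sum>l = 0..<k. P' $$ (i, l) * Q' $$ (l, j)) = (\<Sum>l = 0..<r. P' $$ (i, l) * Q' $$ (l, j))"
      by (rule sum.mono_neutral_right) (use assms(3) ij in \<open>auto simp: P'_def Q'_def\<close>)
    also have "\<dots> = (\<Sum>l = 0..<r. P $$ (i, l) * Q $$ (l, j))"
      by (rule sum.cong) (use assms(3) ij in \<open>auto simp: P'_def Q'_def\<close>)
    finally show "(P * Q) $$ (i, j) = (P' * Q') $$ (i, j)"
      using ij P Q c by (auto simp: scalar_prod_def)
  qed (use P Q c in auto)
  moreover have "det Q' = 0"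
  proof -
    have "Q' = mat\<^sub>r k k (\<lambda>i. if i = r then 0\<^sub>v k else row Q' i)"
      using assms(3) by (intro eq_matI) (auto simp: Q'_def)
    also have "det \<dots> = 0"
      by (rule det_row_0[OF assms(3)]) (use c in auto)
    finally show ?thesis .
  qed
  ultimately show ?thesis using det_mult[OF c] by simp
qed

text \<open>Selecting rows of \<open>P\<close> and columns of \<open>Q\<close> writes the submatrix
  as a product with inner dimension \<open>r\<close>. Having rank at most \<open>r\<close> is thus
  expressed by a factorisation rather than by the rank function.\<close>

lemma principal_minor_mult_eq_0:
  assumes P: "P \<in> carrier_mat n r" and Q: "Q \<in> carrier_mat r n"
    and b: "\<beta> \<subseteq> {..<n}" and "r < card \<beta>"
  shows "principal_minor (P * Q) \<beta> = 0"
proof -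
  let ?P = "mat (card \<beta>) r (\<lambda>(i, j). P $$ (pick \<beta> i, j))"
  let ?Q = "mat r (card \<beta>) (\<lambda>(i, j). Q $$ (i, pick \<beta> j))"
  have PQ: "P * Q \<in> carrier_mat n n" using P Q by simp
  have pn: "pick \<beta> i < n" if "i < card \<beta>" for i
    using pick_in_set_le[OF that] b by auto
  have "submatrix (P * Q) \<beta> \<beta> = ?P * ?Q"
    unfolding submatrix_subset[OF PQ b b]
    by (rule eq_matI) (use P Q in \<open>auto simp: scalar_prod_def pn\<close>)
  then show ?thesis
    unfolding principal_minor_def using det_mult_inner_dim_less[OF _ _ assms(4), of ?P ?Q] by simp
qed

section \<open>Cramer's rule for singular systems\<close>

text \<open>Polynomials that agree at every complex \<open>t\<close> have the same coefficients, and
  the coefficient of \<open>t ^ (n - k)\<close> collects exactly the sets with \<open>k\<close>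
  elements.\<close>

lemma sum_power_card_eqD:
  fixes f g :: "nat set \<Rightarrow> complex"
  assumes eq: "\<And>t. (\<Sum>\<beta>\<in>Pow {..<n}. t ^ (n - card \<beta>) * f \<beta>) = (\<Sum>\<beta>\<in>Pow {..<n}. t ^ (n - card \<beta>) * g \<beta>)"
    and "k \<le> n"
  shows "sum f (index_sets k n) = sum g (index_sets k n)"
proof -
  let ?p = "\<lambda>h. \<Sum>\<beta>\<in>Pow {..<n}. monom (h \<beta> :: complex) (n - card \<beta>)"
  have "poly (?p f) = poly (?p g)"
    by (rule ext) (use eq in \<open>simp add: poly_sum poly_monom mult.commute\<close>)
  then have pq: "?p f = ?p g" by (simp only: poly_eq_poly_eq_iff)
  have "coeff (?p h) (n - k) = sum h (index_sets k n)" for h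
  proof -
    have "coeff (?p h) (n - k) = (\<Sum>\<beta>\<in>Pow {..<n}. if card \<beta> = k then h \<beta> else 0)"
      unfolding coeff_sum
    proof (rule sum.cong[OF refl])
      fix \<beta> assume "\<beta> \<in> Pow {..<n}"
      \<comment> \<open>Both \<open>card \<beta>\<close> and \<open>k\<close> are at most
        \<open>n\<close>, so truncated subtraction does not identify different exponents.\<close>
      then have "card \<beta> \<le> n" using card_mono[of "{..<n}" \<beta>] by simp
      then show "coeff (monom (h \<beta>) (n - card \<beta>)) (n - k) = (if card \<beta> = k then h \<beta> else 0)"
        using assms(2) by auto
    qed
    also have "\<dots> = sum h (index_sets k n)"
      by (simp add: sum.inter_filter[symmetric] index_sets_def Pow_def)
    finally show ?thesis .
  qed
  from this[of f] this[of g] pq show ?thesis by simp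
qed

lemma finite_index_sets [simp]: "finite (index_sets k n)"
  unfolding index_sets_def by (rule finite_subset[of _ "Pow {..<n}"]) auto

text \<open>Cramer's rule for \<open>(M + t I) x = M x + t x\<close>; the coefficient of \<open>t\<^sup>n\<^sup>-\<^sup>r\<close> is the claim, the
  contribution of \<open>t x\<close> consisting of minors of order \<open>r + 1\<close> of a matrix of rank at most \<open>r\<close>.\<close>

lemma sum_principal_minors_cramer:
  fixes P Q :: "complex mat"
  assumes P: "P \<in> carrier_mat n r" and Q: "Q \<in> carrier_mat r n" and "r \<le> n"
    and v: "v \<in> carrier_vec r" and i: "i < n"
    and M_def: "M = P * Q" and x_def: "x = P *\<^sub>v v"
  shows "(\<Sum>\<beta>\<in>index_sets_at r n i. principal_minor (replace_col M (M *\<^sub>v x) i) \<beta>) =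
    x $ i * (\<Sum>\<beta>\<in>index_sets r n. principal_minor M \<beta>)"
proof -
  have M: "M \<in> carrier_mat n n" and x: "x \<in> carrier_vec n" using P Q v M_def x_def by auto
  let ?b = "M *\<^sub>v x"
  let ?C = "replace_col M ?b i"
  have C: "?C \<in> carrier_mat n n" using M by (auto simp: replace_col_def)
  \<comment> \<open>These are the matrices whose determinants are the coefficients of the Cramer
    numerator: columns in \<open>\<beta>\<close> come from \<open>?C\<close>, the others from the
    part multiplied by \<open>t\<close>, which is the identity with \<open>x\<close> in column
    \<open>i\<close>.\<close>
  define mix where "mix \<beta> = mat n n (\<lambda>(a, k). if k \<in> \<beta> then ?C $$ (a, k)
      else if k = i then x $ a else if a = k then 1 else 0)" for \<beta>
  have "(\<Sum>\<beta>\<in>Pow {..<n}. t ^ (n - card \<beta>) * (x $ i * principal_minor M \<beta>)) =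
    (\<Sum>\<beta>\<in>Pow {..<n}. t ^ (n - card \<beta>) * det (mix \<beta>))" for t
  proof -
    define S where "S = mat n n (\<lambda>(a, k). M $$ (a, k) + t * (if a = k then 1 else 0))"
    have S: "S \<in> carrier_mat n n" by (simp add: S_def)
    have Sx: "S *\<^sub>v x = ?b + t \<cdot>\<^sub>v x"
    proof (rule eq_vecI)
      fix a assume "a < dim_vec (?b + t \<cdot>\<^sub>v x)"
      then have a: "a < n" using x by simp
      have "(\<Sum>k = 0..<n. (M $$ (a, k) + t * (if a = k then 1 else 0)) * x $ k) =
        (\<Sum>k = 0..<n. M $$ (a, k) * x $ k) + (\<Sum>k = 0..<n. if a = k then t * x $ k else 0)"
        unfolding sum.distrib[symmetric] by (rule sum.cong) (auto simp: algebra_simps)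
      also have "(\<Sum>k = 0..<n. if a = k then t * x $ k else 0) = t * x $ a"
        using a by simp
      finally show "(S *\<^sub>v x) $ a = (?b + t \<cdot>\<^sub>v x) $ a"
        using a x M by (simp add: S_def scalar_prod_def)
    qed (use S M x in auto)
    have "det S = (\<Sum>\<beta>\<in>Pow {..<n}. t ^ (n - card \<beta>) * principal_minor M \<beta>)"
      unfolding S_def by (subst det_add_smult_cols) (auto simp: principal_minor_conv_det[OF M] intro!: sum.cong)
    moreover have "replace_col S (S *\<^sub>v x) i = mat n n (\<lambda>(a, k). ?C $$ (a, k) +
        t * (if k = i then x $ a else if a = k then 1 else 0))"
      unfolding Sx by (rule eq_matI) (use M x in \<open>auto simp: replace_col_def S_def\<close>)
    then have "det (replace_col S (S *\<^sub>v x) i) = (\<Sum>\<beta>\<in>Pow {..<n}. t ^ (n - card \<beta>) * det (mix \<beta>))"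
      unfolding mix_def by (simp only: det_add_smult_cols)
    ultimately show ?thesis
      using cramer_lemma_mat[OF S x i] by (simp add: sum_distrib_left mult_ac)
  qed
  from sum_power_card_eqD[OF this assms(3)]
  have "x $ i * (\<Sum>\<beta>\<in>index_sets r n. principal_minor M \<beta>) = (\<Sum>\<beta>\<in>index_sets r n. det (mix \<beta>))"
    by (simp add: sum_distrib_left)
  also have "\<dots> = (\<Sum>\<beta>\<in>index_sets_at r n i. det (mix \<beta>))"
  proof (rule sum.mono_neutral_right)
    show "\<forall>\<beta>\<in>index_sets r n - index_sets_at r n i. det (mix \<beta>) = 0"
    proof
      fix \<beta> assume "\<beta> \<in> index_sets r n - index_sets_at r n i"
      then have b: "\<beta> \<subseteq> {..<n}" "card \<beta> = r" "i \<notin> \<beta>" "finite \<beta>"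
        by (auto simp: index_sets_def index_sets_at_def intro: finite_subset)
      \<comment> \<open>For \<open>i\<close> outside \<open>\<beta>\<close> the column
        \<open>x\<close> survives in \<open>mix \<beta>\<close>, which therefore encodes the minor
        of \<open>?L\<close> at \<open>insert i \<beta>\<close>, of order
        \<open>r + 1\<close>.\<close>
      let ?L = "replace_col M x i"
      have L: "?L \<in> carrier_mat n n" using M by (auto simp: replace_col_def)
      have bi: "insert i \<beta> \<subseteq> {..<n}" using b i by auto
      have "mix \<beta> = mat n n (\<lambda>(a, k). if k \<in> insert i \<beta> then ?L $$ (a, k) else if a = k then 1 else 0)"
        unfolding mix_def by (rule eq_matI) (use b(3) M in \<open>auto simp: replace_col_def\<close>)
      then have "det (mix \<beta>) = principal_minor ?L (insert i \<beta>)"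
        using principal_minor_conv_det[OF L bi] by simp
      \<comment> \<open>Here \<open>x\<close> being in the range of \<open>P\<close> matters: the
        replaced column is absorbed into \<open>Q\<close>, so \<open>?L\<close> still factors
        through dimension \<open>r\<close>.\<close>
      also have "?L = P * replace_col Q v i"
        unfolding M_def x_def using P Q v i
        by (intro eq_matI) (auto simp: replace_col_def scalar_prod_def intro!: sum.cong)
      also have "principal_minor \<dots> (insert i \<beta>) = 0"
        by (rule principal_minor_mult_eq_0[OF P _ bi]) (use Q b in \<open>auto simp: replace_col_def\<close>)
      finally show "det (mix \<beta>) = 0" .
    qed
  qed (auto simp: index_sets_at_def)
  also have "\<dots> = (\<Sum>\<beta>\<in>index_sets_at r n i. principal_minor ?C \<beta>)"
  proof (rule sum.cong[OF refl])
    fix \<beta> assume "\<beta> \<in> index_sets_at r n i"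
    then have b: "\<beta> \<subseteq> {..<n}" "i \<in> \<beta>" by (auto simp: index_sets_def index_sets_at_def)
    have "mix \<beta> = mat n n (\<lambda>(a, k). if k \<in> \<beta> then ?C $$ (a, k) else if a = k then 1 else 0)"
      unfolding mix_def by (rule eq_matI) (use b(2) in auto)
    then show "det (mix \<beta>) = principal_minor ?C \<beta>"
      using principal_minor_conv_det[OF C b(1)] by simp
  qed
  finally show ?thesis by simp
qed

lemma principal_minor_transpose:
  assumes M: "M \<in> carrier_mat n n" and "\<alpha> \<subseteq> {..<n}"
  shows "principal_minor (transpose_mat M) \<alpha> = principal_minor M \<alpha>"
proof -
  have pn: "pick \<alpha> i < n" if "i < card \<alpha>" for i
    using pick_in_set_le[OF that] assms(2) by auto
  have "submatrix (transpose_mat M) \<alpha> \<alpha> = transpose_mat (submatrix M \<alpha> \<alpha>)"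
    unfolding submatrix_subset[OF M assms(2) assms(2)]
    by (subst submatrix_subset[of _ n n]) (use assms in \<open>auto simp: pn intro!: eq_matI\<close>)
  moreover have "submatrix M \<alpha> \<alpha> \<in> carrier_mat (card \<alpha>) (card \<alpha>)"
    unfolding submatrix_subset[OF M assms(2) assms(2)] by simp
  ultimately show ?thesis
    unfolding principal_minor_def by (simp add: det_transpose)
qed

text \<open>This is the column version for the transpose of \<open>N\<close>. The left factor there
  is the transpose of \<open>Q\<close>, hence the condition that \<open>y\<close> lies in its range.
  Using the transpose rather than the adjoint keeps conjugates out of the formula.\<close>

lemma sum_principal_minors_cramer_row:
  fixes P Q :: "complex mat"
  assumes P: "P \<in> carrier_mat n r" and Q: "Q \<in> carrier_mat r n" and "r \<le> n"
    and v: "v \<in> carrier_vec r" and j: "j < n"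
    and N_def: "N = P * Q" and y_def: "y = transpose_mat Q *\<^sub>v v"
  shows "(\<Sum>\<alpha>\<in>index_sets_at r n j. principal_minor (replace_row N (transpose_mat N *\<^sub>v y) j) \<alpha>) =
    y $ j * (\<Sum>\<alpha>\<in>index_sets r n. principal_minor N \<alpha>)"
proof -
  let ?T = "transpose_mat N"
  have N: "N \<in> carrier_mat n n" using P Q N_def by simp
  have tr: "?T = transpose_mat Q * transpose_mat P"
    unfolding N_def by (rule transpose_mult[OF P Q])
  let ?R = "replace_row N (?T *\<^sub>v y) j"
  have R: "?R \<in> carrier_mat n n" using N by (auto simp: replace_row_def)
  have RC: "replace_col ?T (?T *\<^sub>v y) j = transpose_mat ?R"
    by (rule eq_matI) (use N in \<open>auto simp: replace_col_def replace_row_def\<close>)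
  have sum_transpose: "sum (principal_minor (transpose_mat K)) X = sum (principal_minor K) X"
    if "K \<in> carrier_mat n n" "X \<subseteq> index_sets r n" for K :: "complex mat" and X
    using that by (intro sum.cong refl principal_minor_transpose) (auto simp: index_sets_def)
  have "(\<Sum>\<beta>\<in>index_sets_at r n j. principal_minor (replace_col ?T (?T *\<^sub>v y) j) \<beta>) =
      y $ j * (\<Sum>\<beta>\<in>index_sets r n. principal_minor ?T \<beta>)"
    by (rule sum_principal_minors_cramer[OF _ _ assms(3) v j tr y_def]) (use P Q in auto)
  then show ?thesis
    unfolding RC using sum_transpose[OF R, of "index_sets_at r n j"] sum_transpose[OF N, of "index_sets r n"]
    by (simp add: index_sets_at_def)
qed

subsection \<open>Rank factorisations and Gram matrices\<close>

text \<open>\<open>C\<close> consists of a maximal independent set of columns of \<open>A\<close>,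
  found at the positions \<open>\<beta>\<close>, and \<open>F\<close> of the coordinates of all
  columns in this basis. The identity block of \<open>F\<close> at \<open>\<beta>\<close> is
  recorded because it supplies a nonzero minor and makes the adjoint of \<open>F\<close>
  injective.\<close>

lemma (in vec_space) rank_factorization:
  assumes A: "A \<in> carrier_mat n nc"
  obtains \<beta> C F where "\<beta> \<in> index_sets (rank A) nc"
    and "C \<in> carrier_mat n (rank A)" and "F \<in> carrier_mat (rank A) nc" and "A = C * F"
    and "\<And>v. v \<in> carrier_vec (rank A) \<Longrightarrow> C *\<^sub>v v = 0\<^sub>v n \<Longrightarrow> v = 0\<^sub>v (rank A)"
    and "\<And>i j. i < rank A \<Longrightarrow> j < rank A \<Longrightarrow> F $$ (i, pick \<beta> j) = (if i = j then 1 else 0)"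
proof -
  define r where "r = rank A"
  have colsA: "set (cols A) \<subseteq> carrier_vec n" using cols_dim A by blast
  have "lin_indpt {}" unfolding lin_dep_def by auto
  then obtain S where S: "maximal S (\<lambda>T. T \<subseteq> set (cols A) \<and> lin_indpt T)" and finS: "finite S"
    using maximal_exists_superset[of "set (cols A)" "\<lambda>T. T \<subseteq> set (cols A) \<and> lin_indpt T" "{}"] by auto
  then have Ssub: "S \<subseteq> set (cols A)" and Sind: "lin_indpt S" and cardS: "card S = r"
    using rank_card_indpt[OF A S] by (auto simp: maximal_def r_def)
  have Scar: "S \<subseteq> carrier_vec n" using Ssub colsA by blast
  have spanS: "w \<in> span S" if "w \<in> set (cols A)" for w
  proof (cases "w \<in> S")
    case True
    then show ?thesis using span_mem Scar by blast
  next
    case False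
    then have "lin_dep (insert w S)"
      using S that Ssub unfolding maximal_def by blast
    then show ?thesis
      using lin_dep_iff_in_span[OF Scar Sind _ False] that colsA by auto
  qed
  have "\<exists>k<nc. col A k = s" if "s \<in> S" for s
    using that Ssub A by (fastforce simp: cols_def)
  \<comment> \<open>Columns of \<open>A\<close> may repeat, so one position is chosen for each
    vector of \<open>S\<close>.\<close>
  then obtain c where c: "\<And>s. s \<in> S \<Longrightarrow> c s < nc \<and> col A (c s) = s" by metis
  define \<beta> where "\<beta> = c ` S"
  have cinj: "inj_on c S" by (rule inj_onI) (metis c)
  have cardb: "card \<beta> = r" unfolding \<beta>_def using card_image[OF cinj] cardS by simp
  have finb: "finite \<beta>" using finS by (simp add: \<beta>_def)
  have bsub: "\<beta> \<subseteq> {..<nc}" using c by (auto simp: \<beta>_def)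
  have colb: "bij_betw (col A) \<beta> S"
    unfolding \<beta>_def by (rule bij_betwI[of _ _ _ c]) (use c in auto)
  have bij: "bij_betw (\<lambda>l. col A (pick \<beta> l)) {..<r} S"
    using bij_betw_trans[OF pick_bij_betw[OF finb, unfolded cardb] colb] by (simp add: comp_def)
  have pn: "pick \<beta> l < nc" if "l < r" for l
    using pick_in_set_le[of l \<beta>] that cardb bsub by auto
  define C where "C = mat n r (\<lambda>(i, l). A $$ (i, pick \<beta> l))"
  have C: "C \<in> carrier_mat n r" by (simp add: C_def)
  have colC: "col C l = col A (pick \<beta> l)" if "l < r" for l
    using that A pn[OF that] by (intro eq_vecI) (auto simp: C_def)
  have colsC: "cols C = map (\<lambda>l. col A (pick \<beta> l)) [0..<r]"
    unfolding cols_def using C colC by auto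
  have distC: "distinct (cols C)"
    unfolding colsC distinct_map using bij by (simp add: bij_betw_def atLeast0LessThan)
  have setC: "set (cols C) = S"
    unfolding colsC using bij by (simp add: bij_betw_def atLeast0LessThan)
  have Cinj: "v = 0\<^sub>v r" if "v \<in> carrier_vec r" "C *\<^sub>v v = 0\<^sub>v n" for v
    using lin_depI[OF C that(1) _ that(2) distC] Sind setC by auto
  have "\<exists>f\<in>carrier_vec r. C *\<^sub>v f = col A j" if "j < nc" for j
  proof -
    have "col A j \<in> set (cols A)" using that A by (auto simp: cols_def)
    then obtain a where "lincomb a S = col A j"
      using spanS finite_in_span[OF finS Scar] by metis
    then show ?thesis using mat_mult_eq_lincomb[OF C distC, of a] setC by auto
  qed
  then obtain f where f: "\<And>j. j < nc \<Longrightarrow> f j \<in> carrier_vec r \<and> C *\<^sub>v f j = col A j" by metis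
  define F where "F = mat r nc (\<lambda>(i, j). f j $ i)"
  have F: "F \<in> carrier_mat r nc" by (simp add: F_def)
  have colF: "col F j = f j" if "j < nc" for j
    using that f[OF that] by (intro eq_vecI) (auto simp: F_def)
  have "A = C * F"
  proof (rule eq_matI)
    fix i j assume "i < dim_row (C * F)" "j < dim_col (C * F)"
    then have ij: "i < n" "j < nc" using C F by auto
    have "(C * F) $$ (i, j) = (C *\<^sub>v f j) $ i"
      using ij C F colF by simp
    then show "A $$ (i, j) = (C * F) $$ (i, j)"
      using f[OF ij(2)] ij A by simp
  qed (use A C F in auto)
  moreover have "F $$ (i, pick \<beta> j) = (if i = j then 1 else 0)" if "i < r" "j < r" for i j
  proof -
    \<comment> \<open>The coordinate vector \<open>f (pick \<beta> j)\<close> and the unit vector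
      \<open>j\<close> have the same image under \<open>C\<close>, so they coincide by
      injectivity.\<close>
    note fj = f[OF pn[OF that(2)]]
    have "C *\<^sub>v (f (pick \<beta> j) - unit_vec r j) = C *\<^sub>v f (pick \<beta> j) - C *\<^sub>v unit_vec r j"
      using C fj by (intro mult_minus_distrib_mat_vec) auto
    also have "C *\<^sub>v unit_vec r j = col C j"
      using C that by (intro eq_vecI) (auto simp: scalar_prod_right_unit)
    also have "C *\<^sub>v f (pick \<beta> j) - col C j = 0\<^sub>v n"
      using fj colC[OF that(2)] A by (intro eq_vecI) auto
    finally have "C *\<^sub>v (f (pick \<beta> j) - unit_vec r j) = 0\<^sub>v n" .
    then have "f (pick \<beta> j) - unit_vec r j = 0\<^sub>v r"
      by (rule Cinj[rotated]) (use fj in auto)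
    then have "(f (pick \<beta> j) - unit_vec r j) $ i = 0" using that by simp
    then show ?thesis using that fj pn by (simp add: F_def)
  qed
  moreover have "\<beta> \<in> index_sets r nc" using bsub cardb by (simp add: index_sets_def)
  ultimately show thesis
    using that C F Cinj unfolding r_def by blast
qed

section \<open>Adjoints and Gram matrices\<close>

lemma mat_adjoint_conv: "mat_adjoint A = mat (dim_col A) (dim_row A) (\<lambda>(i, j). conjugate (A $$ (j, i)))"
  by (rule eq_matI) (auto simp: mat_adjoint_def mat_of_rows_def)

lemma dim_mat_adjoint [simp]:
  "dim_row (mat_adjoint A) = dim_col A" "dim_col (mat_adjoint A) = dim_row A"
  by (simp_all add: mat_adjoint_conv)

lemma mat_adjoint_carrier [simp]:
  "A \<in> carrier_mat m n \<Longrightarrow> mat_adjoint A \<in> carrier_mat n m"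
  by (auto simp: mat_adjoint_conv)

lemma mat_adjoint_adjoint [simp]: "mat_adjoint (mat_adjoint A) = A"
  by (rule eq_matI) (auto simp: mat_adjoint_conv)

lemma mat_adjoint_mult:
  assumes A: "A \<in> carrier_mat m n" and B: "B \<in> carrier_mat n p"
  shows "mat_adjoint (A * B) = mat_adjoint B * mat_adjoint A"
proof (rule eq_matI)
  fix i j assume "i < dim_row (mat_adjoint B * mat_adjoint A)" "j < dim_col (mat_adjoint B * mat_adjoint A)"
  then have ij: "i < p" "j < m" using A B by (auto simp: mat_adjoint_conv)
  then show "mat_adjoint (A * B) $$ (i, j) = (mat_adjoint B * mat_adjoint A) $$ (i, j)"
    using A B by (auto simp: mat_adjoint_conv scalar_prod_def sum_conjugate conjugate_dist_mul mult.commute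
        intro!: sum.cong)
qed (use A B in \<open>auto simp: mat_adjoint_conv\<close>)

lemma det_mat_adjoint:
  assumes A: "A \<in> carrier_mat n n"
  shows "det (mat_adjoint A) = cnj (det A)"
proof -
  interpret cnj: comm_ring_hom cnj by standard auto
  have "mat_adjoint A = map_mat cnj (transpose_mat A)"
    by (rule eq_matI) (auto simp: mat_adjoint_conv)
  then show ?thesis using det_transpose[OF A] by (simp add: cnj.hom_det)
qed

text \<open>If the Gram matrix kills \<open>v\<close>, then moving \<open>C\<close> across the inner
  product shows that \<open>C v\<close> has norm 0, and injectivity of \<open>C\<close> gives
  \<open>v = 0\<close>.\<close>

lemma det_gram_nonzero:
  fixes C :: "complex mat"
  assumes C: "C \<in> carrier_mat m r"
    and inj: "\<And>v. v \<in> carrier_vec r \<Longrightarrow> C *\<^sub>v v = 0\<^sub>v m \<Longrightarrow> v = 0\<^sub>v r"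
  shows "det (mat_adjoint C * C) \<noteq> 0"
proof
  assume "det (mat_adjoint C * C) = 0"
  then obtain v where v: "v \<in> carrier_vec r" "v \<noteq> 0\<^sub>v r" and z: "(mat_adjoint C * C) *\<^sub>v v = 0\<^sub>v r"
    using det_0_iff_vec_prod_zero[OF mult_carrier_mat[OF mat_adjoint_carrier[OF C] C]] by auto
  let ?w = "C *\<^sub>v v"
  have w: "?w \<in> carrier_vec m" using C v by auto
  have z': "mat_adjoint C *\<^sub>v ?w = 0\<^sub>v r"
    using z assoc_mult_mat_vec[OF mat_adjoint_carrier[OF C] C v(1)] by simp
  have "?w \<bullet>c ?w = (\<Sum>i = 0..<m. \<Sum>j = 0..<r. C $$ (i, j) * v $ j * cnj (?w $ i))"
    using C v by (simp add: scalar_prod_def sum_distrib_right)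
  also have "\<dots> = (\<Sum>j = 0..<r. v $ j * cnj ((mat_adjoint C *\<^sub>v ?w) $ j))"
    using C v by (subst sum.swap)
      (auto intro!: sum.cong simp: scalar_prod_def mat_adjoint_conv sum_distrib_left mult_ac)
  also have "\<dots> = 0" unfolding z' by simp
  finally have "?w = 0\<^sub>v m" using w by simp
  from inj[OF v(1) this] v(2) show False by simp
qed

text \<open>The columns of \<open>A\<close> at \<open>\<beta>\<close> form
  \<open>C * Fs \<beta>\<close>, so the minor at \<open>\<beta>\<close> is the fixed nonzero number
  \<open>det ?G\<close> times a squared modulus. Nonnegative reals cannot cancel, and the identity
  block of \<open>F\<close> makes one of them equal to 1.\<close>

lemma sum_principal_minors_gram_nonzero:
  fixes A :: "complex mat"
  assumes C: "C \<in> carrier_mat m r" and F: "F \<in> carrier_mat r n" and AF: "A = C * F"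
    and inj: "\<And>v. v \<in> carrier_vec r \<Longrightarrow> C *\<^sub>v v = 0\<^sub>v m \<Longrightarrow> v = 0\<^sub>v r"
    and b0: "\<beta>\<^sub>0 \<in> index_sets r n"
    and id: "\<And>i j. i < r \<Longrightarrow> j < r \<Longrightarrow> F $$ (i, pick \<beta>\<^sub>0 j) = (if i = j then 1 else 0)"
  shows "(\<Sum>\<beta>\<in>index_sets r n. principal_minor (mat_adjoint A * A) \<beta>) \<noteq> 0"
proof -
  let ?G = "mat_adjoint C * C"
  define Fs where "Fs \<beta> = mat r r (\<lambda>(i, j). F $$ (i, pick \<beta> j))" for \<beta>
  have Fs: "Fs \<beta> \<in> carrier_mat r r" for \<beta> by (simp add: Fs_def)
  have G: "?G \<in> carrier_mat r r" by (rule mult_carrier_mat[OF mat_adjoint_carrier[OF C] C])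
  have "principal_minor (mat_adjoint A * A) \<beta> = det ?G * of_real ((cmod (det (Fs \<beta>)))\<^sup>2)"
    if "\<beta> \<in> index_sets r n" for \<beta>
  proof -
    have b: "\<beta> \<subseteq> {..<n}" and card: "card \<beta> = r" using that by (auto simp: index_sets_def)
    have pn: "pick \<beta> i < n" if "i < r" for i
      using pick_in_set_le[of i \<beta>] b card that by auto
    let ?Cs = "C * Fs \<beta>"
    have Cs: "?Cs \<in> carrier_mat m r" using C Fs by auto
    have A: "A \<in> carrier_mat m n" unfolding AF by (rule mult_carrier_mat[OF C F])
    then have AA: "mat_adjoint A * A \<in> carrier_mat n n"
      by (intro mult_carrier_mat[OF mat_adjoint_carrier])
    have colA: "?Cs $$ (i, j) = A $$ (i, pick \<beta> j)" if "i < m" "j < r" for i j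
      using that C F pn[OF that(2)] by (auto simp: AF Fs_def scalar_prod_def)
    have "submatrix (mat_adjoint A * A) \<beta> \<beta> = mat_adjoint ?Cs * ?Cs"
    proof (rule eq_matI)
      fix i j assume "i < dim_row (mat_adjoint ?Cs * ?Cs)" "j < dim_col (mat_adjoint ?Cs * ?Cs)"
      then have ij: "i < r" "j < r" using Cs by (auto simp: mat_adjoint_conv Fs_def)
      have "submatrix (mat_adjoint A * A) \<beta> \<beta> $$ (i, j) = (mat_adjoint A * A) $$ (pick \<beta> i, pick \<beta> j)"
        unfolding submatrix_subset[OF AA b b] card using ij by simp
      also have "\<dots> = (\<Sum>k = 0..<m. cnj (A $$ (k, pick \<beta> i)) * A $$ (k, pick \<beta> j))"
        using ij pn A by (simp add: mat_adjoint_conv scalar_prod_def)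
      also have "\<dots> = (\<Sum>k = 0..<m. cnj (?Cs $$ (k, i)) * ?Cs $$ (k, j))"
        by (rule sum.cong) (use ij colA in auto)
      also have "\<dots> = (mat_adjoint ?Cs * ?Cs) $$ (i, j)"
        using ij Cs C Fs by (simp add: mat_adjoint_conv scalar_prod_def Fs_def del: index_mult_mat(1)) 
           (simp add: scalar_prod_def)
      finally show "submatrix (mat_adjoint A * A) \<beta> \<beta> $$ (i, j) = (mat_adjoint ?Cs * ?Cs) $$ (i, j)" .
    qed (use Fs[of \<beta>] in \<open>simp_all add: submatrix_subset[OF AA b b] card\<close>)
    also have "mat_adjoint ?Cs * ?Cs = mat_adjoint (Fs \<beta>) * (?G * Fs \<beta>)"
      unfolding mat_adjoint_mult[OF C Fs]
      using C Fs[of \<beta>] by (simp add: assoc_mult_mat[of _ r m _ r _ r] assoc_mult_mat[of _ r r _ m _ r])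
    also have "det \<dots> = cnj (det (Fs \<beta>)) * (det ?G * det (Fs \<beta>))"
      using G Fs by (simp add: det_mult[of _ r] det_mat_adjoint[OF Fs])
    finally show ?thesis
      unfolding principal_minor_def complex_norm_square by (simp add: mult_ac)
  qed
  then have "(\<Sum>\<beta>\<in>index_sets r n. principal_minor (mat_adjoint A * A) \<beta>) =
      det ?G * of_real (\<Sum>\<beta>\<in>index_sets r n. (cmod (det (Fs \<beta>)))\<^sup>2)"
    by (simp add: sum_distrib_left)
  moreover have "Fs \<beta>\<^sub>0 = 1\<^sub>m r"
    by (rule eq_matI) (auto simp: Fs_def id)
  then have "(\<Sum>\<beta>\<in>index_sets r n. (cmod (det (Fs \<beta>)))\<^sup>2) > 0"
    by (intro sum_pos2[OF _ b0]) auto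
  then have "complex_of_real (\<Sum>\<beta>\<in>index_sets r n. (cmod (det (Fs \<beta>)))\<^sup>2) \<noteq> 0"
    by (simp only: of_real_eq_0_iff)
  ultimately show ?thesis using det_gram_nonzero[OF C inj] by (metis mult_eq_0_iff)
qed

subsection \<open>Least squares solutions of minimum norm\<close>

lemma minus_mat_eq_0D:
  fixes A B :: "'a :: group_add mat"
  assumes A: "A \<in> carrier_mat n m" and B: "B \<in> carrier_mat n m" and "A - B = 0\<^sub>m n m"
  shows "A = B"
proof (rule eq_matI)
  fix i j assume "i < dim_row B" "j < dim_col B"
  then have "(A - B) $$ (i, j) = 0" "i < n" "j < m" using assms by auto
  then show "A $$ (i, j) = B $$ (i, j)" using A B by simp
qed (use A B in auto)

section \<open>The Frobenius inner product\<close>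

definition frobenius_inner :: "complex mat \<Rightarrow> complex mat \<Rightarrow> complex" where
  "frobenius_inner X Y = (\<Sum>i<dim_row X. \<Sum>j<dim_col X. X $$ (i, j) * cnj (Y $$ (i, j)))"

lemma frobenius_inner_commute:
  assumes "X \<in> carrier_mat n p" "Y \<in> carrier_mat n p"
  shows "cnj (frobenius_inner X Y) = frobenius_inner Y X"
  using assms by (simp add: frobenius_inner_def mult.commute)

lemma frobenius_inner_mult_left:
  assumes "A \<in> carrier_mat m n" "X \<in> carrier_mat n p" "Y \<in> carrier_mat m p"
  shows "frobenius_inner (A * X) Y = frobenius_inner X (mat_adjoint A * Y)"
proof -
  have "frobenius_inner (A * X) Y = (\<Sum>i<m. \<Sum>j<p. \<Sum>k<n. A $$ (i, k) * X $$ (k, j) * cnj (Y $$ (i, j)))"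
    using assms by (simp add: frobenius_inner_def scalar_prod_def sum_distrib_right atLeast0LessThan)
  also have "\<dots> = (\<Sum>i<m. \<Sum>k<n. \<Sum>j<p. A $$ (i, k) * X $$ (k, j) * cnj (Y $$ (i, j)))"
    by (rule sum.cong[OF refl], rule sum.swap)
  also have "\<dots> = (\<Sum>k<n. \<Sum>i<m. \<Sum>j<p. A $$ (i, k) * X $$ (k, j) * cnj (Y $$ (i, j)))"
    by (rule sum.swap)
  also have "\<dots> = (\<Sum>k<n. \<Sum>j<p. \<Sum>i<m. A $$ (i, k) * X $$ (k, j) * cnj (Y $$ (i, j)))"
    by (rule sum.cong[OF refl], rule sum.swap)
  also have "\<dots> = frobenius_inner X (mat_adjoint A * Y)"
    using assms by (simp add: frobenius_inner_def mat_adjoint_conv scalar_prod_def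
        sum_distrib_left atLeast0LessThan mult_ac)
  finally show ?thesis .
qed

lemma frobenius_inner_adjoint:
  assumes "X \<in> carrier_mat n p" "Y \<in> carrier_mat n p"
  shows "frobenius_inner (mat_adjoint X) (mat_adjoint Y) = cnj (frobenius_inner X Y)"
  using assms by (subst (2) frobenius_inner_def, subst frobenius_inner_def)
    (simp add: mat_adjoint_conv, rule sum.swap)

text \<open>Taking adjoints turns multiplication on the right into multiplication on the left, at
  the price of conjugating both sides.\<close>

lemma frobenius_inner_mult_right:
  assumes X: "X \<in> carrier_mat m n" and B: "B \<in> carrier_mat n p" and Y: "Y \<in> carrier_mat m p"
  shows "frobenius_inner (X * B) Y = frobenius_inner X (Y * mat_adjoint B)"
proof -
  have "cnj (frobenius_inner (X * B) Y) = frobenius_inner (mat_adjoint B * mat_adjoint X) (mat_adjoint Y)"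
    unfolding mat_adjoint_mult[OF X B, symmetric]
    by (rule frobenius_inner_adjoint[symmetric, of _ m p]) (use assms in auto)
  also have "\<dots> = frobenius_inner (mat_adjoint X) (mat_adjoint (mat_adjoint B) * mat_adjoint Y)"
    by (rule frobenius_inner_mult_left[of _ p n _ m]) (use assms in auto)
  also have "\<dots> = cnj (frobenius_inner X (Y * mat_adjoint B))"
    unfolding mat_adjoint_mult[OF Y mat_adjoint_carrier[OF B], symmetric]
    by (rule frobenius_inner_adjoint[of _ m n]) (use assms in auto)
  finally show ?thesis by simp
qed

lemma frobenius_norm_sq:
  "(frobenius_norm M)\<^sup>2 = (\<Sum>i<dim_row M. \<Sum>j<dim_col M. (cmod (M $$ (i, j)))\<^sup>2)"
  unfolding frobenius_norm_def by (intro real_sqrt_pow2 sum_nonneg) auto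

lemma frobenius_inner_self: "frobenius_inner X X = of_real ((frobenius_norm X)\<^sup>2)"
  unfolding frobenius_norm_sq frobenius_inner_def by (simp add: complex_norm_square[symmetric])

lemma frobenius_norm_eq_0D:
  assumes "frobenius_norm X = 0" and X: "X \<in> carrier_mat n p"
  shows "X = 0\<^sub>m n p"
proof (rule eq_matI)
  fix i j assume "i < dim_row (0\<^sub>m n p)" "j < dim_col (0\<^sub>m n p)"
  then have ij: "i < n" "j < p" by auto
  have "(\<Sum>i<n. \<Sum>j<p. (cmod (X $$ (i, j)))\<^sup>2) = 0"
    using frobenius_norm_sq[of X] assms by simp
  then have "(\<Sum>j<p. (cmod (X $$ (i, j)))\<^sup>2) = 0"
    using ij by (subst (asm) sum_nonneg_eq_0_iff) (auto intro: sum_nonneg)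
  then have "(cmod (X $$ (i, j)))\<^sup>2 = 0"
    using ij by (subst (asm) sum_nonneg_eq_0_iff) auto
  then show "X $$ (i, j) = 0\<^sub>m n p $$ (i, j)" using ij by simp
qed (use X in auto)

lemma frobenius_norm_sq_add_smult:
  assumes X: "X \<in> carrier_mat n p" and Z: "Z \<in> carrier_mat n p"
  shows "(frobenius_norm (X + of_real t \<cdot>\<^sub>m Z))\<^sup>2 =
    (frobenius_norm X)\<^sup>2 + 2 * t * Re (frobenius_inner X Z) + t\<^sup>2 * (frobenius_norm Z)\<^sup>2"
proof -
  have "(cmod (x + of_real t * z))\<^sup>2 = (cmod x)\<^sup>2 + 2 * t * Re (x * cnj z) + t\<^sup>2 * (cmod z)\<^sup>2" for x z
    unfolding cmod_power2 by (simp add: power2_eq_square algebra_simps)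
  then show ?thesis
    using X Z by (simp add: frobenius_norm_sq frobenius_inner_def sum.distrib sum_distrib_left distrib_left)
qed

text \<open>Along the real line through \<open>X\<close> in direction \<open>Z\<close> the squared
  norm is a quadratic polynomial in \<open>t\<close>; with a nonzero linear coefficient it would
  drop below its value at 0.\<close>

lemma frobenius_inner_eq_0_if_minimal:
  assumes X: "X \<in> carrier_mat n p" and Z: "Z \<in> carrier_mat n p"
    and le: "\<And>t :: real. frobenius_norm X \<le> frobenius_norm (X + of_real t \<cdot>\<^sub>m Z)"
  shows "Re (frobenius_inner X Z) = 0"
proof (rule ccontr)
  let ?b = "Re (frobenius_inner X Z)"
  define c where "c = (frobenius_norm Z)\<^sup>2"
  assume b: "?b \<noteq> 0"
  have c: "c \<ge> 0" by (simp add: c_def)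
  \<comment> \<open>The vertex of the parabola would be at \<open>- ?b / c\<close>; adding 1 keeps
    the denominator positive without a separate case \<open>c = 0\<close>, and the change is still
    negative.\<close>
  define t where "t = - ?b / (c + 1)"
  have nonneg: "frobenius_norm X \<ge> 0"
    by (auto simp: frobenius_norm_def intro!: sum_nonneg)
  have "(frobenius_norm X)\<^sup>2 \<le> (frobenius_norm (X + of_real t \<cdot>\<^sub>m Z))\<^sup>2"
    using le[of t] nonneg by (rule power_mono)
  then have "0 \<le> 2 * t * ?b + t\<^sup>2 * c"
    unfolding frobenius_norm_sq_add_smult[OF X Z] c_def by simp
  also have "2 * t * ?b + t\<^sup>2 * c = - (?b\<^sup>2 * (c + 2)) / (c + 1)\<^sup>2"
    using c by (simp add: t_def power2_eq_square divide_simps) (simp add: algebra_simps)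
  also have "\<dots> < 0"
    using b c by (intro divide_neg_pos) auto
  finally show False by simp
qed

section \<open>Normal equation and orthogonality\<close>

text \<open>The squared residual is stationary at \<open>X\<close>. Its variation in the direction
  of its own gradient is a multiple of the squared norm of that gradient, which must therefore
  vanish.\<close>

lemma least_squares_normal_equation:
  assumes A: "A \<in> carrier_mat m n" and B: "B \<in> carrier_mat p q" and D: "D \<in> carrier_mat m q"
    and X: "X \<in> least_squares_solutions A B D"
  shows "mat_adjoint A * A * X * (B * mat_adjoint B) = mat_adjoint A * D * mat_adjoint B"
proof -
  have Xc: "X \<in> carrier_mat n p"
    and min: "\<And>Y. Y \<in> carrier_mat n p \<Longrightarrow> frobenius_norm (A * X * B - D) \<le> frobenius_norm (A * Y * B - D)"
    using X A B unfolding least_squares_solutions_def is_arg_min_def by (auto simp: not_less)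
  note A' = mat_adjoint_carrier[OF A] and B' = mat_adjoint_carrier[OF B]
  define R where "R = A * X * B - D"
  have AXB: "A * X * B \<in> carrier_mat m q" using A Xc B by simp
  have R: "R \<in> carrier_mat m q" unfolding R_def by (rule minus_carrier_mat[OF D])
  \<comment> \<open>Up to a factor, \<open>E\<close> is the gradient of the squared residual norm at
    \<open>X\<close>. With this direction the real part of the inner product is already the squared
    norm of \<open>E\<close>.\<close>
  define E where "E = mat_adjoint A * R * mat_adjoint B"
  have E: "E \<in> carrier_mat n p" using A' B' R by (simp add: E_def)
  have AE: "A * E \<in> carrier_mat m p" and AEB: "A * E * B \<in> carrier_mat m q" using A E B by auto
  have "A * (X + c \<cdot>\<^sub>m E) * B - D = R + c \<cdot>\<^sub>m (A * E * B)" for c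
  proof -
    have "A * (X + c \<cdot>\<^sub>m E) = A * X + c \<cdot>\<^sub>m (A * E)"
      using A Xc E by (simp add: mult_add_distrib_mat[of _ m n _ p] mult_smult_distrib[of _ m n _ p])
    also have "\<dots> * B = A * X * B + c \<cdot>\<^sub>m (A * E * B)"
      using A Xc AE B by (simp add: add_mult_distrib_mat[of _ m p _ _ q] mult_smult_assoc_mat[of _ m p _ q])
    finally have eq: "A * (X + c \<cdot>\<^sub>m E) * B = A * X * B + c \<cdot>\<^sub>m (A * E * B)" .
    have "S + c \<cdot>\<^sub>m T - D = S - D + c \<cdot>\<^sub>m T" if "S \<in> carrier_mat m q" "T \<in> carrier_mat m q" for S T
      using that D by (intro eq_matI) auto
    from this[OF AXB AEB] show ?thesis unfolding R_def eq .
  qed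
  then have "Re (frobenius_inner R (A * E * B)) = 0"
    using min[of "X + of_real t \<cdot>\<^sub>m E" for t] Xc E
    by (intro frobenius_inner_eq_0_if_minimal[OF R AEB]) (simp add: R_def[symmetric])
  moreover have "cnj (frobenius_inner R (A * E * B)) = frobenius_inner (A * E * B) R"
    by (rule frobenius_inner_commute[OF R AEB])
  moreover have "frobenius_inner (A * E * B) R = frobenius_inner E (mat_adjoint A * (R * mat_adjoint B))"
    using frobenius_inner_mult_right[OF AE B R] frobenius_inner_mult_left[OF A E] R B' by simp
  moreover have "mat_adjoint A * (R * mat_adjoint B) = E"
    unfolding E_def by (rule assoc_mult_mat[OF A' R B', symmetric])
  ultimately have "Re (frobenius_inner E E) = 0"
    by (metis cnj.simps(1))
  then have "frobenius_norm E = 0"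
    by (simp only: frobenius_inner_self Re_complex_of_real zero_eq_power2)
  then have "E = 0\<^sub>m n p" using frobenius_norm_eq_0D E by blast
  moreover have "E = mat_adjoint A * A * X * (B * mat_adjoint B) - mat_adjoint A * D * mat_adjoint B"
  proof -
    have "E = (mat_adjoint A * (A * X * B) - mat_adjoint A * D) * mat_adjoint B"
      unfolding E_def R_def using mult_minus_distrib_mat[OF A' AXB D] by simp
    also have "\<dots> = mat_adjoint A * (A * X * B) * mat_adjoint B - mat_adjoint A * D * mat_adjoint B"
      by (rule minus_mult_distrib_mat[OF mult_carrier_mat[OF A' AXB] mult_carrier_mat[OF A' D] B'])
    also have "mat_adjoint A * (A * X * B) * mat_adjoint B = mat_adjoint A * A * X * (B * mat_adjoint B)"
      using assoc_mult_mat[OF A' mult_carrier_mat[OF A Xc] B] assoc_mult_mat[OF A' A Xc]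
        assoc_mult_mat[OF mult_carrier_mat[OF mult_carrier_mat[OF A' A] Xc] B B'] by simp
    finally show ?thesis .
  qed
  ultimately have z: "mat_adjoint A * A * X * (B * mat_adjoint B) - mat_adjoint A * D * mat_adjoint B = 0\<^sub>m n p"
    by simp
  show ?thesis
    by (rule minus_mat_eq_0D[OF _ _ z]) (use A' B' A B Xc D in auto)
qed

text \<open>Adding a multiple of \<open>Z\<close> leaves \<open>A X B\<close> unchanged, so the
  whole line through \<open>X\<close> in direction \<open>Z\<close> consists of least squares
  solutions, and \<open>X\<close> has the smallest norm on it.\<close>

lemma min_norm_orthogonal:
  assumes A: "A \<in> carrier_mat m n" and B: "B \<in> carrier_mat p q"
    and X: "is_min_norm_least_squares_solution A B D X"
    and Z: "Z \<in> carrier_mat n p" and AZB: "A * Z * B = 0\<^sub>m m q"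
  shows "Re (frobenius_inner X Z) = 0"
proof -
  have LS: "X \<in> least_squares_solutions A B D"
    and min: "\<And>Y. Y \<in> least_squares_solutions A B D \<Longrightarrow> frobenius_norm X \<le> frobenius_norm Y"
    using X unfolding is_min_norm_least_squares_solution_def is_arg_min_def by (auto simp: not_less)
  have Xc: "X \<in> carrier_mat n p"
    using LS A B unfolding least_squares_solutions_def is_arg_min_def by auto
  have "X + c \<cdot>\<^sub>m Z \<in> least_squares_solutions A B D" for c
  proof -
    have "A * (X + c \<cdot>\<^sub>m Z) = A * X + c \<cdot>\<^sub>m (A * Z)"
      using A Xc Z by (simp add: mult_add_distrib_mat[of _ m n _ p] mult_smult_distrib[of _ m n _ p])
    also have "\<dots> * B = A * X * B + c \<cdot>\<^sub>m (A * Z * B)"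
      using mult_carrier_mat[OF A Xc] mult_carrier_mat[OF A Z] B
      by (simp add: add_mult_distrib_mat[of _ m p _ _ q] mult_smult_assoc_mat[of _ m p _ q])
    also have "\<dots> = A * X * B"
      unfolding AZB using A B by (intro eq_matI) auto
    finally show ?thesis
      using LS Xc Z A B unfolding least_squares_solutions_def is_arg_min_def by auto
  qed
  then show ?thesis
    by (intro frobenius_inner_eq_0_if_minimal[OF Xc Z] min)
qed

text \<open>Let \<open>Z\<close> be \<open>X\<close> minus its orthogonal projection to the range of
  \<open>P\<close>. The adjoint of \<open>P\<close> kills \<open>Z\<close>, so \<open>Z\<close> is
  orthogonal to the projection, and by hypothesis the real part of its inner product with
  \<open>X\<close> is 0. Hence \<open>Z\<close> has norm 0.\<close>

lemma in_range_if_orthogonal: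
  assumes P: "P \<in> carrier_mat n r" and X: "X \<in> carrier_mat n p"
    and nz: "det (mat_adjoint P * P) \<noteq> 0"
    and orth: "\<And>Z. Z \<in> carrier_mat n p \<Longrightarrow> mat_adjoint P * Z = 0\<^sub>m r p \<Longrightarrow> Re (frobenius_inner X Z) = 0"
  obtains V where "V \<in> carrier_mat r p" and "X = P * V"
proof -
  note P' = mat_adjoint_carrier[OF P]
  have PP: "mat_adjoint P * P \<in> carrier_mat r r" by (rule mult_carrier_mat[OF P' P])
  from det_non_zero_imp_unit[OF PP nz, of "()"]
  obtain W where W: "W \<in> carrier_mat r r" and inv: "mat_adjoint P * P * W = 1\<^sub>m r"
    by (auto simp: Units_def ring_mat_def)
  \<comment> \<open>With \<open>W\<close> the inverse of the Gram matrix of \<open>P\<close>, the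
    product \<open>P * V\<close> is the orthogonal projection of \<open>X\<close>.\<close>
  define V where "V = W * (mat_adjoint P * X)"
  have PX: "mat_adjoint P * X \<in> carrier_mat r p" using P' X by simp
  have V: "V \<in> carrier_mat r p" unfolding V_def by (rule mult_carrier_mat[OF W PX])
  have PV: "P * V \<in> carrier_mat n p" using P V by simp
  define Z where "Z = X - P * V"
  have Z: "Z \<in> carrier_mat n p" unfolding Z_def by (rule minus_carrier_mat[OF PV])
  have "mat_adjoint P * (P * V) = mat_adjoint P * P * W * (mat_adjoint P * X)"
    unfolding V_def using assoc_mult_mat[OF P' P V] assoc_mult_mat[OF PP W PX] V_def by simp
  then have "mat_adjoint P * (P * V) = mat_adjoint P * X"
    using inv left_mult_one_mat[OF PX] by simp
  then have PZ: "mat_adjoint P * Z = 0\<^sub>m r p"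
    unfolding Z_def mult_minus_distrib_mat[OF P' X PV] using PX by simp
  have "frobenius_inner Z Z = frobenius_inner X Z - frobenius_inner (P * V) Z"
    using X PV P V by (simp add: Z_def frobenius_inner_def sum_subtractf[symmetric] left_diff_distrib)
  also have "frobenius_inner (P * V) Z = 0"
    unfolding frobenius_inner_mult_left[OF P V Z] PZ using V by (simp add: frobenius_inner_def)
  finally have "Re (frobenius_inner Z Z) = 0"
    using orth[OF Z PZ] by simp
  then have "frobenius_norm Z = 0"
    by (simp only: frobenius_inner_self Re_complex_of_real zero_eq_power2)
  then have "Z = 0\<^sub>m n p" by (rule frobenius_norm_eq_0D[OF _ Z])
  then have "X = P * V"
    using minus_mat_eq_0D[OF X PV] by (simp add: Z_def)
  with V show thesis using that by blast
qed

subsection \<open>The determinantal representation\<close>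

text \<open>Let \<open>s\<close> be the rank of the adjoint. The principal minors of order
  \<open>s\<close> of \<open>A * mat_adjoint A\<close>, the Gram matrix of the adjoint, have nonzero
  sum. If \<open>s\<close> exceeded the rank of \<open>A\<close>, they would all vanish, since this
  matrix factors through that rank.\<close>

lemma rank_mat_adjoint_le:
  assumes A: "A \<in> carrier_mat m n"
  shows "vec_space.rank n (mat_adjoint A) \<le> vec_space.rank m (A :: complex mat)"
proof (rule ccontr)
  let ?r = "vec_space.rank m A" and ?s = "vec_space.rank n (mat_adjoint A)"
  assume "\<not> ?s \<le> ?r"
  then have less: "?r < ?s" by simp
  note A' = mat_adjoint_carrier[OF A]
  obtain \<beta> C F where \<beta>: "\<beta> \<in> index_sets ?s m" and C: "C \<in> carrier_mat n ?s"
    and F: "F \<in> carrier_mat ?s m" and CF: "mat_adjoint A = C * F"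
    and inj: "\<And>v. v \<in> carrier_vec ?s \<Longrightarrow> C *\<^sub>v v = 0\<^sub>v n \<Longrightarrow> v = 0\<^sub>v ?s"
    and id: "\<And>i j. i < ?s \<Longrightarrow> j < ?s \<Longrightarrow> F $$ (i, pick \<beta> j) = (if i = j then 1 else 0)"
    by (rule vec_space.rank_factorization[OF A']) blast
  have "(\<Sum>\<beta>\<in>index_sets ?s m. principal_minor (A * mat_adjoint A) \<beta>) \<noteq> 0"
    using sum_principal_minors_gram_nonzero[OF C F CF inj \<beta> id] by simp
  moreover obtain K L where K: "K \<in> carrier_mat m ?r" and L: "L \<in> carrier_mat ?r n" and KL: "A = K * L"
    by (rule vec_space.rank_factorization[OF A]) blast
  have "A * mat_adjoint A = K * (L * mat_adjoint A)"
    using assoc_mult_mat[OF K L A'] KL by simp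
  then have "principal_minor (A * mat_adjoint A) \<beta> = 0" if "\<beta> \<in> index_sets ?s m" for \<beta>
    using principal_minor_mult_eq_0[OF K mult_carrier_mat[OF L A'], of \<beta>] that less
    by (simp add: index_sets_def)
  ultimately show False by simp
qed

lemma rank_mat_adjoint:
  assumes A: "A \<in> carrier_mat m n"
  shows "vec_space.rank n (mat_adjoint A) = vec_space.rank m (A :: complex mat)"
  using rank_mat_adjoint_le[OF A] rank_mat_adjoint_le[OF mat_adjoint_carrier[OF A]] by simp

lemma sum_principal_minors_gram_rank_nonzero:
  assumes A: "A \<in> carrier_mat m n"
  shows "(\<Sum>\<beta>\<in>index_sets (vec_space.rank m A) n. principal_minor (mat_adjoint A * A) \<beta>) \<noteq> (0 :: complex)"
  by (rule vec_space.rank_factorization[OF A]) (rule sum_principal_minors_gram_nonzero)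

text \<open>The adjoint of \<open>F\<close> is injective: by the identity block, entry
  \<open>pick \<beta> j\<close> of the image of \<open>v\<close> is just
  \<open>v $ j\<close>.\<close>

lemma det_gram_adjoint_nonzero:
  fixes F :: "complex mat"
  assumes F: "F \<in> carrier_mat r n" and b: "\<beta> \<in> index_sets r n"
    and id: "\<And>i j. i < r \<Longrightarrow> j < r \<Longrightarrow> F $$ (i, pick \<beta> j) = (if i = j then 1 else 0)"
  shows "det (F * mat_adjoint F) \<noteq> 0"
proof -
  have "v = 0\<^sub>v r" if v: "v \<in> carrier_vec r" and z: "mat_adjoint F *\<^sub>v v = 0\<^sub>v n" for v
  proof (rule eq_vecI)
    fix j assume "j < dim_vec (0\<^sub>v r :: complex vec)"
    then have j: "j < r" by simp
    have pn: "pick \<beta> j < n"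
      using pick_in_set_le[of j \<beta>] b j by (auto simp: index_sets_def)
    have "(\<Sum>i = 0..<r. cnj (F $$ (i, pick \<beta> j)) * v $ i) = (mat_adjoint F *\<^sub>v v) $ pick \<beta> j"
      using F v pn by (simp add: mat_adjoint_conv scalar_prod_def)
    moreover have "(\<Sum>i = 0..<r. cnj (F $$ (i, pick \<beta> j)) * v $ i) = (\<Sum>i = 0..<r. if i = j then v $ i else 0)"
      by (rule sum.cong) (use j id in auto)
    ultimately show "v $ j = 0\<^sub>v r $ j" using z pn j by simp
  qed (use v in simp)
  then show ?thesis
    using det_gram_nonzero[OF mat_adjoint_carrier[OF F]] by simp
qed

lemma row_mult_mat:
  fixes K L :: "'a :: comm_semiring_0 mat"
  assumes "K \<in> carrier_mat n a" and "L \<in> carrier_mat a b" and "k < n"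
  shows "row (K * L) k = transpose_mat L *\<^sub>v row K k"
  using assms by (intro eq_vecI) (auto intro: comm_scalar_prod[of _ a])

section \<open>The auxiliary vectors and the entries of the solution\<close>

text \<open>Entry \<open>l\<close> is the singular Cramer rule for column \<open>l\<close> of the
  system \<open>mat_adjoint A * A * Y = Dt\<close>. The rule applies because the adjoint of
  \<open>F\<close> is the left factor both of \<open>Y\<close> and of the coefficient
  matrix.\<close>

lemma dA_minors_eq:
  assumes A: "A \<in> carrier_mat m n" and C: "C \<in> carrier_mat m r" and F: "F \<in> carrier_mat r n"
    and CF: "A = C * F" and V: "V \<in> carrier_mat r p" and "r \<le> n" and i: "i < n"
    and Y: "Y = mat_adjoint F * V" and Dt: "Dt = mat_adjoint A * A * Y"
  shows "dA_minors r A Dt i =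
    (\<Sum>\<beta>\<in>index_sets r n. principal_minor (mat_adjoint A * A) \<beta>) \<cdot>\<^sub>v row Y i"
proof -
  note F' = mat_adjoint_carrier[OF F] and C' = mat_adjoint_carrier[OF C] and A' = mat_adjoint_carrier[OF A]
  have M: "mat_adjoint A * A \<in> carrier_mat n n" by (rule mult_carrier_mat[OF A' A])
  have Yc: "Y \<in> carrier_mat n p" unfolding Y by (rule mult_carrier_mat[OF F' V])
  have Dtc: "Dt \<in> carrier_mat n p" unfolding Dt by (rule mult_carrier_mat[OF M Yc])
  have MPQ: "mat_adjoint A * A = mat_adjoint F * (mat_adjoint C * A)"
    using mat_adjoint_mult[OF C F] assoc_mult_mat[OF F' C' A] CF by simp
  show ?thesis
  proof (rule eq_vecI)
    fix l assume "l < dim_vec ((\<Sum>\<beta>\<in>index_sets r n. principal_minor (mat_adjoint A * A) \<beta>) \<cdot>\<^sub>v row Y i)"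
    then have l: "l < p" using Yc by simp
    have col: "col Dt l = mat_adjoint A * A *\<^sub>v col Y l"
      unfolding Dt by (rule col_mult2[OF M Yc l])
    have colY: "col Y l = mat_adjoint F *\<^sub>v col V l"
      unfolding Y by (rule col_mult2[OF F' V l])
    have "(\<Sum>\<beta>\<in>index_sets_at r n i. principal_minor (replace_col (mat_adjoint A * A) (mat_adjoint A * A *\<^sub>v col Y l) i) \<beta>) =
      col Y l $ i * (\<Sum>\<beta>\<in>index_sets r n. principal_minor (mat_adjoint A * A) \<beta>)"
      by (rule sum_principal_minors_cramer[OF F' mult_carrier_mat[OF C' A] \<open>r \<le> n\<close> _ i MPQ colY])
        (use V l in auto)
    then show "dA_minors r A Dt i $ l =
        ((\<Sum>\<beta>\<in>index_sets r n. principal_minor (mat_adjoint A * A) \<beta>) \<cdot>\<^sub>v row Y i) $ l"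
      using l i A Yc Dtc by (simp add: dA_minors_def col mult.commute)
  qed (use Yc Dtc in \<open>simp add: dA_minors_def\<close>)
qed

text \<open>The mirror image: each entry solves one row of
  \<open>Z * (B * mat_adjoint B) = Dt\<close>, with the adjoint of \<open>C\<close> as the common
  right factor.\<close>

lemma dB_minors_eq:
  assumes B: "B \<in> carrier_mat p q" and C: "C \<in> carrier_mat p r" and F: "F \<in> carrier_mat r q"
    and CF: "B = C * F" and V: "V \<in> carrier_mat n r" and "r \<le> p" and j: "j < p"
    and Z: "Z = V * mat_adjoint C" and Dt: "Dt = Z * (B * mat_adjoint B)"
  shows "dB_minors r B Dt j =
    (\<Sum>\<alpha>\<in>index_sets r p. principal_minor (B * mat_adjoint B) \<alpha>) \<cdot>\<^sub>v col Z j"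
proof -
  note F' = mat_adjoint_carrier[OF F] and C' = mat_adjoint_carrier[OF C] and B' = mat_adjoint_carrier[OF B]
  have N: "B * mat_adjoint B \<in> carrier_mat p p" by (rule mult_carrier_mat[OF B B'])
  have Zc: "Z \<in> carrier_mat n p" unfolding Z by (rule mult_carrier_mat[OF V C'])
  have Dtc: "Dt \<in> carrier_mat n p" unfolding Dt by (rule mult_carrier_mat[OF Zc N])
  have NPQ: "B * mat_adjoint B = B * mat_adjoint F * mat_adjoint C"
    using mat_adjoint_mult[OF C F] assoc_mult_mat[OF B F' C'] CF by simp
  show ?thesis
  proof (rule eq_vecI)
    fix k assume "k < dim_vec ((\<Sum>\<alpha>\<in>index_sets r p. principal_minor (B * mat_adjoint B) \<alpha>) \<cdot>\<^sub>v col Z j)"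
    then have k: "k < n" using Zc by simp
    have row: "row Dt k = transpose_mat (B * mat_adjoint B) *\<^sub>v row Z k"
      unfolding Dt by (rule row_mult_mat[OF Zc N k])
    have rowZ: "row Z k = transpose_mat (mat_adjoint C) *\<^sub>v row V k"
      unfolding Z by (rule row_mult_mat[OF V C' k])
    have "(\<Sum>\<alpha>\<in>index_sets_at r p j. principal_minor (replace_row (B * mat_adjoint B)
        (transpose_mat (B * mat_adjoint B) *\<^sub>v row Z k) j) \<alpha>) =
      row Z k $ j * (\<Sum>\<alpha>\<in>index_sets r p. principal_minor (B * mat_adjoint B) \<alpha>)"
      by (rule sum_principal_minors_cramer_row[OF mult_carrier_mat[OF B F'] C' \<open>r \<le> p\<close> _ j NPQ rowZ])
        (use V k in auto)
    then show "dB_minors r B Dt j $ k =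
        ((\<Sum>\<alpha>\<in>index_sets r p. principal_minor (B * mat_adjoint B) \<alpha>) \<cdot>\<^sub>v col Z j) $ k"
      using k j B Zc Dtc by (simp add: dB_minors_def row mult.commute)
  qed (use Zc Dtc in \<open>simp add: dB_minors_def\<close>)
qed

text \<open>The equation \<open>Dt = ?M * X * ?N\<close> is solved in two stages. For the row
  formula the first stage finds \<open>X * ?N\<close> up to the factor \<open>a\<close> and the
  second finds \<open>X\<close>, with the further factor \<open>b\<close>; the column formula treats
  the two sides in the opposite order. No relation of the ranks to \<open>n\<close> and
  \<open>p\<close> is fixed, so all four cases of the theorem are instances.\<close>

lemma min_norm_least_squares_entry:
  fixes A B D X Dt :: "complex mat"
  assumes A: "A \<in> carrier_mat m n" and r1: "vec_space.rank m A = r1"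
    and B: "B \<in> carrier_mat p q" and r2: "vec_space.rank p B = r2"
    and D: "D \<in> carrier_mat m q"
    and X: "is_min_norm_least_squares_solution A B D X"
    and Dt: "Dt = mat_adjoint A * D * mat_adjoint B"
    and i: "i < n" and j: "j < p"
  defines "a \<equiv> \<Sum>\<beta>\<in>index_sets r1 n. principal_minor (mat_adjoint A * A) \<beta>"
    and "b \<equiv> \<Sum>\<alpha>\<in>index_sets r2 p. principal_minor (B * mat_adjoint B) \<alpha>"
  shows "X $$ (i, j) = (\<Sum>\<beta>\<in>index_sets_at r1 n i.
      principal_minor (replace_col (mat_adjoint A * A) (dB_minors r2 B Dt j) i) \<beta>) / (a * b)" (is ?col)
    and "X $$ (i, j) = (\<Sum>\<alpha>\<in>index_sets_at r2 p j.
      principal_minor (replace_row (B * mat_adjoint B) (dA_minors r1 A Dt i) j) \<alpha>) / (a * b)" (is ?row)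
proof -
  note A' = mat_adjoint_carrier[OF A] and B' = mat_adjoint_carrier[OF B]
  let ?M = "mat_adjoint A * A" and ?N = "B * mat_adjoint B"
  have M: "?M \<in> carrier_mat n n" and N: "?N \<in> carrier_mat p p"
    by (rule mult_carrier_mat[OF A' A], rule mult_carrier_mat[OF B B'])
  have LS: "X \<in> least_squares_solutions A B D"
    using X by (simp add: is_min_norm_least_squares_solution_def is_arg_min_def)
  then have Xc: "X \<in> carrier_mat n p"
    using A B by (simp add: least_squares_solutions_def is_arg_min_def)
  have Dt_eq: "Dt = ?M * X * ?N"
    unfolding Dt by (rule least_squares_normal_equation[OF A B D LS, symmetric])
  have a: "a \<noteq> 0"
    unfolding a_def r1[symmetric] by (rule sum_principal_minors_gram_rank_nonzero[OF A])
  \<comment> \<open>\<open>?N\<close> is the Gram matrix of the adjoint of \<open>B\<close>, so the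
    rank that governs its minors is that of the adjoint, which equals \<open>r2\<close>.\<close>
  have b: "b \<noteq> 0"
    using sum_principal_minors_gram_rank_nonzero[OF B'] rank_mat_adjoint[OF B]
    unfolding b_def r2[symmetric] by simp
  obtain \<beta> C F where C: "C \<in> carrier_mat m r1" and F: "F \<in> carrier_mat r1 n" and CF: "A = C * F"
    and \<beta>: "\<beta> \<in> index_sets r1 n"
    and idF: "\<And>i j. i < r1 \<Longrightarrow> j < r1 \<Longrightarrow> F $$ (i, pick \<beta> j) = (if i = j then 1 else 0)"
    by (rule vec_space.rank_factorization[OF A, unfolded r1]) blast
  obtain G H where G: "G \<in> carrier_mat p r2" and H: "H \<in> carrier_mat r2 q" and GH: "B = G * H"
    and injG: "\<And>v. v \<in> carrier_vec r2 \<Longrightarrow> G *\<^sub>v v = 0\<^sub>v p \<Longrightarrow> v = 0\<^sub>v r2"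
    by (rule vec_space.rank_factorization[OF B, unfolded r2]) blast
  note F' = mat_adjoint_carrier[OF F] and G' = mat_adjoint_carrier[OF G]
  have r1n: "r1 \<le> n" using vec_space.rank_le_nc[OF A] r1 by simp
  have r2p: "r2 \<le> p" using vec_space.rank_le_nc[OF B'] rank_mat_adjoint[OF B] r2 by simp
  \<comment> \<open>A matrix killed by \<open>F\<close> is killed by \<open>A = C * F\<close>, hence
    \<open>X\<close> is orthogonal to it and lies in the range of the adjoint of
    \<open>F\<close>.\<close>
  obtain V where V: "V \<in> carrier_mat r1 p" and XV: "X = mat_adjoint F * V"
  proof (rule in_range_if_orthogonal[OF F' Xc])
    show "det (mat_adjoint (mat_adjoint F) * mat_adjoint F) \<noteq> 0"
      using det_gram_adjoint_nonzero[OF F \<beta> idF] by simp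
    fix Z assume Z: "Z \<in> carrier_mat n p" and "mat_adjoint (mat_adjoint F) * Z = 0\<^sub>m r1 p"
    then have "A * Z * B = 0\<^sub>m m q"
      using assoc_mult_mat[OF C F Z] C B CF by simp
    then show "Re (frobenius_inner X Z) = 0" by (rule min_norm_orthogonal[OF A B X Z])
  qed
  \<comment> \<open>The same argument for the rows of \<open>X\<close>, read as columns of its
    adjoint: if the adjoint of \<open>G\<close> kills \<open>Z\<close>, then multiplying the adjoint
    of \<open>Z\<close> by \<open>B = G * H\<close> gives 0.\<close>
  obtain W where W: "W \<in> carrier_mat r2 n" and XW: "mat_adjoint X = G * W"
  proof (rule in_range_if_orthogonal[OF G mat_adjoint_carrier[OF Xc]])
    show "det (mat_adjoint G * G) \<noteq> 0" by (rule det_gram_nonzero[OF G injG])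
    fix Z assume Z: "Z \<in> carrier_mat p n" and GZ: "mat_adjoint G * Z = 0\<^sub>m r2 n"
    note Z' = mat_adjoint_carrier[OF Z]
    have "mat_adjoint Z * G = mat_adjoint (0\<^sub>m r2 n)"
      using mat_adjoint_mult[OF G' Z] GZ by simp
    also have "\<dots> = 0\<^sub>m n r2" by (rule eq_matI) (auto simp: mat_adjoint_conv)
    finally have "mat_adjoint Z * B = 0\<^sub>m n q"
      using assoc_mult_mat[OF Z' G H] H GH by simp
    then have "A * mat_adjoint Z * B = 0\<^sub>m m q"
      using assoc_mult_mat[OF A Z' B] A by simp
    then have "Re (frobenius_inner X (mat_adjoint Z)) = 0"
      by (rule min_norm_orthogonal[OF A B X Z'])
    then show "Re (frobenius_inner (mat_adjoint X) Z) = 0"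
      using frobenius_inner_adjoint[OF Xc Z'] by simp
  qed
  note W' = mat_adjoint_carrier[OF W]
  have XW': "X = mat_adjoint W * mat_adjoint G"
    using mat_adjoint_mult[OF G W] XW by (metis mat_adjoint_adjoint)
  have XN: "X * ?N \<in> carrier_mat n p" and MX: "?M * X \<in> carrier_mat n p"
    by (rule mult_carrier_mat[OF Xc N], rule mult_carrier_mat[OF M Xc])

  have "dA_minors r1 A Dt i = a \<cdot>\<^sub>v row (X * ?N) i"
    unfolding a_def
  proof (rule dA_minors_eq[OF A C F CF _ r1n i])
    show "V * ?N \<in> carrier_mat r1 p" by (rule mult_carrier_mat[OF V N])
    show "X * ?N = mat_adjoint F * (V * ?N)"
      using assoc_mult_mat[OF F' V N] XV by simp
    show "Dt = ?M * (X * ?N)"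
      using assoc_mult_mat[OF M Xc N] Dt_eq by simp
  qed
  \<comment> \<open>Second stage: the scaled row of \<open>X * ?N\<close> is the right-hand side of
    a system with matrix \<open>?N\<close> whose unknown is row \<open>i\<close> of \<open>X\<close>
    times \<open>a\<close>.\<close>
  also have "\<dots> = transpose_mat ?N *\<^sub>v (a \<cdot>\<^sub>v row X i)"
    using N Xc i by (simp add: row_mult_mat[OF Xc N i] mult_mat_vec[of _ p p])
  finally have dA: "dA_minors r1 A Dt i = transpose_mat ?N *\<^sub>v (a \<cdot>\<^sub>v row X i)" .
  have NPQ: "?N = B * mat_adjoint H * mat_adjoint G"
    using mat_adjoint_mult[OF G H] assoc_mult_mat[OF B mat_adjoint_carrier[OF H] G'] GH by simp
  have y: "a \<cdot>\<^sub>v row X i = transpose_mat (mat_adjoint G) *\<^sub>v (a \<cdot>\<^sub>v row (mat_adjoint W) i)"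
    using W' G' i by (subst XW') (simp add: row_mult_mat[OF W' G' i] mult_mat_vec[of _ p r2])
  have "(\<Sum>\<alpha>\<in>index_sets_at r2 p j. principal_minor (replace_row ?N (dA_minors r1 A Dt i) j) \<alpha>) =
      (a \<cdot>\<^sub>v row X i) $ j * b"
    unfolding dA b_def
    by (rule sum_principal_minors_cramer_row[OF mult_carrier_mat[OF B mat_adjoint_carrier[OF H]] G' r2p _ j NPQ y])
      (use W' i in auto)
  then show ?row using a b Xc i j by simp

  have "dB_minors r2 B Dt j = b \<cdot>\<^sub>v col (?M * X) j"
    unfolding b_def
  proof (rule dB_minors_eq[OF B G H GH _ r2p j])
    show "?M * mat_adjoint W \<in> carrier_mat n r2" by (rule mult_carrier_mat[OF M W'])
    show "?M * X = ?M * mat_adjoint W * mat_adjoint G"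
      using assoc_mult_mat[OF M W' G'] XW' by simp
  qed (rule Dt_eq)
  also have "\<dots> = ?M *\<^sub>v (b \<cdot>\<^sub>v col X j)"
    using M Xc j by (simp add: col_mult2[OF M Xc j] mult_mat_vec[of _ n n])
  finally have dB: "dB_minors r2 B Dt j = ?M *\<^sub>v (b \<cdot>\<^sub>v col X j)" .
  have MPQ: "?M = mat_adjoint F * (mat_adjoint C * A)"
    using mat_adjoint_mult[OF C F] assoc_mult_mat[OF F' mat_adjoint_carrier[OF C] A] CF by simp
  have x: "b \<cdot>\<^sub>v col X j = mat_adjoint F *\<^sub>v (b \<cdot>\<^sub>v col V j)"
    using V F' j by (subst XV) (simp add: col_mult2[OF F' V j] mult_mat_vec[of _ n r1])
  have "(\<Sum>\<beta>\<in>index_sets_at r1 n i. principal_minor (replace_col ?M (dB_minors r2 B Dt j) i) \<beta>) =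
      (b \<cdot>\<^sub>v col X j) $ i * a"
    unfolding dB a_def
    by (rule sum_principal_minors_cramer[OF F' mult_carrier_mat[OF mat_adjoint_carrier[OF C] A] r1n _ i MPQ x])
      (use V j in auto)
  then show ?col using a b Xc i j by simp
qed

section \<open>Full rank as a special case\<close>

lemma principal_minor_full:
  assumes "K \<in> carrier_mat n n"
  shows "principal_minor K {..<n} = det (K :: 'a :: idom mat)"
proof -
  have "mat n n (\<lambda>(a, k). if k \<in> {..<n} then K $$ (a, k) else if a = k then 1 else 0) = K"
    by (rule eq_matI) (use assms in auto)
  then show ?thesis using principal_minor_conv_det[OF assms order_refl] by simp
qed

lemma index_sets_full: "index_sets n n = {{..<n}}"
proof -
  have "\<alpha> = {..<n}" if "\<alpha> \<subseteq> {..<n}" "card \<alpha> = n" for \<alpha>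
    using card_subset_eq[OF _ that(1)] that(2) by simp
  then show ?thesis by (auto simp: index_sets_def)
qed

lemma index_sets_at_full: "i < n \<Longrightarrow> index_sets_at n n i = {{..<n}}"
  by (auto simp: index_sets_at_def index_sets_full)

lemma dA_minors_full:
  assumes "A \<in> carrier_mat m n" and "i < n"
  shows "dA_minors n A Dt i = dA_det A Dt i"
  using assms by (simp add: dA_minors_def dA_det_def index_sets_at_full principal_minor_full replace_col_def)

lemma dB_minors_full:
  assumes "B \<in> carrier_mat p q" and "j < p"
  shows "dB_minors p B Dt j = dB_det B Dt j"
  using assms by (simp add: dB_minors_def dB_det_def index_sets_at_full principal_minor_full replace_row_def)

theorem theorem3p6:
  fixes A B D X Dt :: "complex mat"
    and m n p q r1 r2 i j :: nat
  assumes "A \<in> carrier_mat m n" and "vec_space.rank m A = r1" and "1 \<le> r1"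
    and "B \<in> carrier_mat p q" and "vec_space.rank p B = r2" and "1 \<le> r2"
    and "D \<in> carrier_mat m q"
    and "is_min_norm_least_squares_solution A B D X"
    and "Dt = mat_adjoint A * D * mat_adjoint B"
    and "i < n" and "j < p"
  shows
    "(r1 = n \<and> r2 = p \<longrightarrow>
        X $$ (i, j) =
          det (replace_col (mat_adjoint A * A) (dB_det B Dt j) i)
            / (det (mat_adjoint A * A) * det (B * mat_adjoint B))
      \<and> X $$ (i, j) =
          det (replace_row (B * mat_adjoint B) (dA_det A Dt i) j)
            / (det (mat_adjoint A * A) * det (B * mat_adjoint B)))
    \<and>
    (r1 < n \<and> r2 < p \<longrightarrow>
        X $$ (i, j) =
          (\<Sum>\<beta> \<in> index_sets_at r1 n i.
             principal_minor (replace_col (mat_adjoint A * A) (dB_minors r2 B Dt j) i) \<beta>)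
            / ((\<Sum>\<beta> \<in> index_sets r1 n. principal_minor (mat_adjoint A * A) \<beta>)
               * (\<Sum>\<alpha> \<in> index_sets r2 p. principal_minor (B * mat_adjoint B) \<alpha>))
      \<and> X $$ (i, j) =
          (\<Sum>\<alpha> \<in> index_sets_at r2 p j.
             principal_minor (replace_row (B * mat_adjoint B) (dA_minors r1 A Dt i) j) \<alpha>)
            / ((\<Sum>\<beta> \<in> index_sets r1 n. principal_minor (mat_adjoint A * A) \<beta>)
               * (\<Sum>\<alpha> \<in> index_sets r2 p. principal_minor (B * mat_adjoint B) \<alpha>)))
    \<and>
    (r1 = n \<and> r2 < p \<longrightarrow>
        X $$ (i, j) =
          det (replace_col (mat_adjoint A * A) (dB_minors r2 B Dt j) i)
            / (det (mat_adjoint A * A)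
               * (\<Sum>\<alpha> \<in> index_sets r2 p. principal_minor (B * mat_adjoint B) \<alpha>))
      \<and> X $$ (i, j) =
          (\<Sum>\<alpha> \<in> index_sets_at r2 p j.
             principal_minor (replace_row (B * mat_adjoint B) (dA_det A Dt i) j) \<alpha>)
            / (det (mat_adjoint A * A)
               * (\<Sum>\<alpha> \<in> index_sets r2 p. principal_minor (B * mat_adjoint B) \<alpha>)))
    \<and>
    (r1 < n \<and> r2 = p \<longrightarrow>
        X $$ (i, j) =
          det (replace_row (B * mat_adjoint B) (dA_minors r1 A Dt i) j)
            / ((\<Sum>\<beta> \<in> index_sets r1 n. principal_minor (mat_adjoint A * A) \<beta>)
               * det (B * mat_adjoint B))
      \<and> X $$ (i, j) =
          (\<Sum>\<beta> \<in> index_sets_at r1 n i.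
             principal_minor (replace_col (mat_adjoint A * A) (dB_det B Dt j) i) \<beta>)
            / ((\<Sum>\<beta> \<in> index_sets r1 n. principal_minor (mat_adjoint A * A) \<beta>)
               * det (B * mat_adjoint B)))"
proof -
  \<comment> \<open>When a rank equals the size of its Gram matrix, \<open>{..<n}\<close> or
    \<open>{..<p}\<close> is the only index set and contains every index, so sums of minors collapse
    to determinants. The facts \<open>Mc\<close> and \<open>Nr\<close> are stated for every
    \<open>v\<close> because the inserted vector differs between the cases.\<close>
  note entry = min_norm_least_squares_entry[OF assms(1,2,4,5,7-11)]
  have M: "principal_minor (mat_adjoint A * A) {..<n} = det (mat_adjoint A * A)"
    and Mc: "principal_minor (replace_col (mat_adjoint A * A) v i) {..<n} = det (replace_col (mat_adjoint A * A) v i)"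
    and N: "principal_minor (B * mat_adjoint B) {..<p} = det (B * mat_adjoint B)"
    and Nr: "principal_minor (replace_row (B * mat_adjoint B) v j) {..<p} = det (replace_row (B * mat_adjoint B) v j)"
    for v
    using assms(1,4) by (auto intro!: principal_minor_full simp: replace_col_def replace_row_def)
  note full = index_sets_full index_sets_at_full[OF assms(10)] index_sets_at_full[OF assms(11)]
    dA_minors_full[OF assms(1,10)] dB_minors_full[OF assms(4,11)] M Mc N Nr
  show ?thesis
    using entry by (auto simp: full)
qed

end
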